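(* Let $n\geq 1$, $0<T<\infty$, $\mathbb{R}^{n+1}_T=\mathbb{R}^n\times(0,T)$. Let $A=((a_{jk}))$ be a real symmetric positive definite $n\times n$ matrix, $b=(b_1,\dots,b_n)\in\mathbb{R}^n$, $c\in\mathbb{R}$, $\alpha\in(0,1)$, and $p\in(n+2,\infty]$ with $1/p+1/p'=1$. For $f\in L^p(\mathbb{R}^{n+1}_T)\cap C^\alpha(\overline{\mathbb{R}^{n+1}_T})$ let $u$ be the solution of the Cauchy problem $$\frac{\partial u}{\partial t}=\sum_{j,k=1}^n a_{jk}\frac{\partial^2 u}{\partial x_j\partial x_k}+\sum_{j=1}^n b_j\frac{\partial u}{\partial x_j}+cu+f(x,t) \ \text{ in } \mathbb{R}^{n+1}_T,\qquad u\big|_{t=0}=0,$$ given by $u(x,t)=\int_0^t\int_{\mathbb{R}^n}G(x-y,t-\tau)f(y,\tau)\,dy\,d\tau$ with $G(x,t)=\frac{e^{ct}}{(2\sqrt{\pi t})^n\det A^{1/2}}e^{-\frac{1}{4t}|A^{-1/2}(x+tb)|^2}$. Let $(x,t)\in\mathbb{R}^{n+1}_T$ and let $\ell\in\mathbb{R}^n$ be a unit vector. Then the sharp (smallest possible) coefficient $\mathcal{C}_{p,\ell}(t)$ in the inequality $$\left|\frac{\partial u}{\partial\ell}(x,t)\right|\leq\mathcal{C}_{p,\ell}(t)\,\|f\|_{p,t}$$ (for all such $f$) is $$\mathcal{C}_{p,\ell}(t)=\frac{|A^{-1/2}\ell|}{\left\{2^n\pi^{(n+p-1)/2}\det A^{1/2}\right\}^{1/p}}\left\{\frac{\Gamma\left(\frac{p'+1}{2}\right)}{p'^{(n+p')/2}}\int_0^t\frac{e^{p'c\tau}}{\tau^{(n(p'-1)+p')/2}}\,d\tau\right\}^{1/p'}.$$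 Consequently, the sharp coefficient $\mathcal{C}_p(t)$ in the inequality $|\nabla_x u(x,t)|\leq\mathcal{C}_p(t)\|f\|_{p,t}$ is $\mathcal{C}_p(t)=\max_{|\ell|=1}\mathcal{C}_{p,\ell}(t)$, namely $$\mathcal{C}_p(t)=\frac{\|A^{-1/2}\|}{\left\{2^n\pi^{(n+p-1)/2}\det A^{1/2}\right\}^{1/p}}\left\{\frac{\Gamma\left(\frac{p'+1}{2}\right)}{p'^{(n+p')/2}}\int_0^t\frac{e^{p'c\tau}}{\tau^{(n(p'-1)+p')/2}}\,d\tau\right\}^{1/p'},$$ and in particular $\mathcal{C}_\infty(t)=\frac{\|A^{-1/2}\|}{\sqrt{\pi}}\int_0^t\frac{e^{c\tau}}{\sqrt{\tau}}\,d\tau$.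
   Context: $A^{1/2}$, $A^{-1/2}$ are the positive definite square roots of $A$ and $A^{-1}$. $|\cdot|$ is the Euclidean norm on $\mathbb{R}^n$; $\|B\|=\max_{|\ell|=1}|B\ell|$ is the spectral norm of a real matrix $B$. $C^\alpha(\overline{\mathbb{R}^{n+1}_T})$ denotes the space of functions $f(x,t)$ that are continuous and bounded on $\overline{\mathbb{R}^{n+1}_T}$ and locally Hölder continuous with exponent $\alpha$ in $x\in\mathbb{R}^n$, uniformly with respect to $t\in[0,T]$. For $0<t\leq T$, $\|f\|_{p,t}=\left(\int_0^t\int_{\mathbb{R}^n}|f(x,\tau)|^p\,dx\,d\tau\right)^{1/p}$ for $p<\infty$, and $\|f\|_{\infty,t}$ is the essential supremum of $|f|$ over $\mathbb{R}^n\times(0,t)$. $\partial u/\partial\ell=(\nabla_x u,\ell)$. For $p=\infty$, $p'=1$ and the factor $\{\cdots\}^{1/p}$ equals $1$.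
   Formalization: For p=∞ the factor {…}^{1/p} is taken as its limit √π, not 1 as the convention says (that contradicts the stated C_∞), so C_{∞,ℓ}=|A^{-1/2}ℓ|/√π·∫e^{cτ}/√τ dτ; the identity C_p=max_ℓ C_{p,ℓ} is not stated separately but is immediate from the formulas. *)

theory Defs
  imports "HOL-Analysis.Analysis" "HOL-Probability.Probability"
begin

definition symmetric_mat :: "real^'n^'n \<Rightarrow> bool" where
  "symmetric_mat A \<longleftrightarrow> transpose A = A"

definition pos_def_mat :: "real^'n^'n \<Rightarrow> bool" where
  "pos_def_mat A \<longleftrightarrow> (\<forall>x. x \<noteq> 0 \<longrightarrow> x \<bullet> (A *v x) > 0)"

definition psd_sqrt :: "real^'n^'n \<Rightarrow> real^'n^'n" where
  "psd_sqrt A = (THE S. symmetric_mat S \<and> pos_def_mat S \<and> S ** S = A)"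

definition inv_sqrt :: "real^'n^'n \<Rightarrow> real^'n^'n" where
  "inv_sqrt A = psd_sqrt (matrix_inv A)"

definition heat_kernel :: "real^'n^'n \<Rightarrow> real^'n \<Rightarrow> real \<Rightarrow> real^'n \<Rightarrow> real \<Rightarrow> real" where
  "heat_kernel A b c x t =
     exp (c * t) / ((2 * sqrt (pi * t)) ^ CARD('n) * det (psd_sqrt A)) *
     exp (- (1 / (4 * t)) * (norm (inv_sqrt A *v (x + t *\<^sub>R b)))\<^sup>2)"

definition heat_solution ::
  "real^'n^'n \<Rightarrow> real^'n \<Rightarrow> real \<Rightarrow> ((real^'n) \<times> real \<Rightarrow> real) \<Rightarrow> real^'n \<Rightarrow> real \<Rightarrow> real" where
  "heat_solution A b c f x t =
     set_lebesgue_integral lborel {0<..<t}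
       (\<lambda>\<tau>. integral\<^sup>L lborel (\<lambda>y. heat_kernel A b c (x - y) (t - \<tau>) * f (y, \<tau>)))"

definition grad_x :: "(real^'n \<Rightarrow> real \<Rightarrow> real) \<Rightarrow> real^'n \<Rightarrow> real \<Rightarrow> real^'n" where
  "grad_x u x t = (\<chi> i. frechet_derivative (\<lambda>y. u y t) (at x) (axis i 1))"

definition dir_deriv :: "(real^'n \<Rightarrow> real \<Rightarrow> real) \<Rightarrow> real^'n \<Rightarrow> real^'n \<Rightarrow> real \<Rightarrow> real" where
  "dir_deriv u l x t = grad_x u x t \<bullet> l"

definition strip :: "real \<Rightarrow> ((real^'n) \<times> real) set" where
  "strip t = UNIV \<times> {0<..<t}"

definition holder_class :: "real \<Rightarrow> real \<Rightarrow> ((real^'n) \<times> real \<Rightarrow> real) \<Rightarrow> bool" where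
  "holder_class \<alpha> T f \<longleftrightarrow>
     continuous_on (UNIV \<times> {0..T}) f \<and> bounded (f ` (UNIV \<times> {0..T})) \<and>
     (\<forall>K. compact K \<longrightarrow> (\<exists>M. \<forall>t\<in>{0..T}. \<forall>x\<in>K. \<forall>y\<in>K.
        \<bar>f (x, t) - f (y, t)\<bar> \<le> M * dist x y powr \<alpha>))"

definition in_Lp :: "real \<Rightarrow> real \<Rightarrow> ((real^'n) \<times> real \<Rightarrow> real) \<Rightarrow> bool" where
  "in_Lp p T f \<longleftrightarrow> set_borel_measurable lborel (strip T) f \<and>
     (\<integral>\<^sup>+ z. indicator (strip T) z * ennreal (\<bar>f z\<bar> powr p) \<partial>lborel) < \<infinity>"

definition Lp_norm :: "real \<Rightarrow> real \<Rightarrow> ((real^'n) \<times> real \<Rightarrow> real) \<Rightarrow> real" where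
  "Lp_norm p t f =
     enn2real (\<integral>\<^sup>+ z. indicator (strip t) z * ennreal (\<bar>f z\<bar> powr p) \<partial>lborel) powr (1 / p)"

definition in_Linf :: "real \<Rightarrow> ((real^'n) \<times> real \<Rightarrow> real) \<Rightarrow> bool" where
  "in_Linf T f \<longleftrightarrow> set_borel_measurable lborel (strip T) f \<and>
     (\<exists>M. AE z in lborel. z \<in> strip T \<longrightarrow> \<bar>f z\<bar> \<le> M)"

definition Linf_norm :: "real \<Rightarrow> ((real^'n) \<times> real \<Rightarrow> real) \<Rightarrow> real" where
  "Linf_norm t f = real_of_ereal (esssup (restrict_space lborel (strip t)) (\<lambda>z. ereal \<bar>f z\<bar>))"

text \<open>The explicit sharp constants (finite p, with p' = p/(p-1)); v = |A^{-1/2} l| or ||A^{-1/2}||.\<close>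
definition sharp_const :: "real^'n^'n \<Rightarrow> real \<Rightarrow> real \<Rightarrow> real \<Rightarrow> real \<Rightarrow> real" where
  "sharp_const A c p t v =
     (let n = real CARD('n); q = p / (p - 1) in
      v / (2 ^ CARD('n) * pi powr ((n + p - 1) / 2) * det (psd_sqrt A)) powr (1 / p) *
      (Gamma ((q + 1) / 2) / q powr ((n + q) / 2) *
       set_lebesgue_integral lborel {0<..<t}
         (\<lambda>\<tau>. exp (q * c * \<tau>) / \<tau> powr ((n * (q - 1) + q) / 2))) powr (1 / q))"

definition sharp_const_inf :: "real \<Rightarrow> real \<Rightarrow> real \<Rightarrow> real" where
  "sharp_const_inf c t v =
     v / sqrt pi * set_lebesgue_integral lborel {0<..<t} (\<lambda>\<tau>. exp (c * \<tau>) / sqrt \<tau>)"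

definition least_in :: "real set \<Rightarrow> real \<Rightarrow> bool" where
  "least_in S C \<longleftrightarrow> C \<in> S \<and> (\<forall>D\<in>S. C \<le> D)"

end

theory Submission
  imports Defs
begin

text \<open>
  Since \<open>\<nabla>G\<close> is integrable on the strip and \<open>f\<close> is bounded and continuous, \<open>\<nabla>u = \<nabla>G * f\<close>: Fubini's
  theorem gives \<open>u(x + h) - u(x) = \<integral>\<^sub>0\<^sup>1 (\<nabla>G * f)(x + \<theta>h) \<bullet> h d\<theta>\<close>, and \<open>\<nabla>G * f\<close> is continuous by
  dominated convergence. Hence \<open>\<partial>u/\<partial>l\<close> is the pairing of \<open>f\<close> with \<open>P = \<partial>G/\<partial>l\<close>, and by duality the
  sharp coefficient is the \<open>L\<^sup>q\<close> norm of \<open>P\<close> on the strip, \<open>q = p/(p - 1)\<close>; it is computed by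
  diagonalizing \<open>A\<close> and rotating \<open>A\<^sup>-\<^sup>1\<^sup>/\<^sup>2 l\<close> to a coordinate axis. The extremal \<open>sgn P |P|\<^sup>q\<^sup>-\<^sup>1\<close> of
  Hoelder's inequality is not admissible, but it is the limit of functions which are cut off near the
  singularity at time \<open>t\<close> and smoothed near the zeros of \<open>P\<close>, and dominated convergence gives sharpness.
\<close>

section \<open>The positive definite square root\<close>

text \<open>The difference quotients of u cannot be dominated directly: the supremum of |grad G(.,
  s)| over small increments has an integral of order s^(-(n+1)/2), which diverges in s at 0.
  Averaging over the segment uses only the L^1 norm of grad G, of order s^(-1/2) at time s. To have
  a convolution on all of R^(n+1), the kernel is cut to times in (0, t), and f is extended by
  freezing it before time 0 and after time T.

  At time s the q-th power integral of dG/dl is a constant times exp(q c s) s^(-(n(q-1)+q)/2), and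
  this exponent is integrable at 0 exactly when p > n + 2. The case p = infinity is q = 1 of the
  same computation.

  The ideal extremal fails twice: for q > 1 it is unbounded near (x, t), and across the zeros of P
  it is only Hoelder with exponent q - 1, which may lie below alpha (for q = 1 it jumps). Its
  approximants stay below it in absolute value, so their norms are controlled at once and only the
  pairing has to converge.\<close>

lemma quadratic_nonpos_imp_linear_zero:
  fixes a b :: real
  assumes "\<And>e. 2 * e * a + e\<^sup>2 * b \<le> 0"
  shows "a = 0"
proof (rule ccontr)
  assume a: "a \<noteq> 0"
  \<comment> \<open>For this e the quadratic term is at least -e a, so the whole expression is at
    least e a = a^2 / (|b| + 1) > 0.\<close>
  define e where "e = a / (\<bar>b\<bar> + 1)"
  have "e\<^sup>2 * b \<ge> - (e\<^sup>2 * (\<bar>b\<bar> + 1))"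
    using mult_left_mono[of "- (\<bar>b\<bar> + 1)" b "e\<^sup>2"] zero_le_power2[of e] by (simp add: algebra_simps)
  moreover have "e\<^sup>2 * (\<bar>b\<bar> + 1) = e * a"
    by (simp add: e_def power2_eq_square)
  moreover have "e * a > 0"
    using a by (simp add: e_def) (metis abs_ge_zero add_nonneg_pos not_real_square_gt_zero zero_less_divide_iff zero_less_one)
  ultimately show False using assms[of e] by simp
qed

text \<open>A maximizer u of the quadratic form x . f x on the unit sphere of V is an eigenvector,
  and the maximum is its eigenvalue. Moving u by e w with w in V orthogonal to u gives the
  first-order condition u . f w = 0.\<close>

lemma selfadjoint_eigenvector:
  fixes f :: "'a::euclidean_space \<Rightarrow> 'a"
  assumes f: "linear f" and sa: "\<And>x y. f x \<bullet> y = x \<bullet> f y"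
    and V: "subspace V" "f ` V \<subseteq> V" "V \<noteq> {0}"
  obtains u k where "u \<in> V" "norm u = 1" "f u = k *\<^sub>R u"
proof -
  let ?S = "sphere 0 1 \<inter> V"
  obtain v where v: "v \<in> V" "v \<noteq> 0" using V subspace_0 by blast
  then have "(1 / norm v) *\<^sub>R v \<in> ?S"
    by (auto simp: V(1) subspace_scale)
  then have ne: "?S \<noteq> {}" by blast
  have comp: "compact ?S"
    by (intro compact_Int_closed compact_sphere closed_subspace V)
  have "continuous_on ?S (\<lambda>x. x \<bullet> f x)"
    by (intro continuous_intros linear_continuous_on f[unfolded linear_conv_bounded_linear])
  from continuous_attains_sup[OF comp ne this]
  obtain u where u: "u \<in> ?S" and max: "\<And>y. y \<in> ?S \<Longrightarrow> y \<bullet> f y \<le> u \<bullet> f u" by blast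
  define k where "k = u \<bullet> f u"
  have uu: "u \<bullet> u = 1" "u \<in> V" "norm u = 1" using u by (auto simp: norm_eq_1)
  have le: "y \<bullet> f y \<le> k * (y \<bullet> y)" if "y \<in> V" for y
  proof (cases "y = 0")
    case True
    then show ?thesis by (simp add: linear_0[OF f])
  next
    case False
    have "(1 / norm y) *\<^sub>R y \<in> ?S" using False that by (auto simp: V(1) subspace_scale)
    from max[OF this] have "(1 / norm y)\<^sup>2 * (y \<bullet> f y) \<le> k"
      by (simp add: linear_cmul[OF f] k_def power2_eq_square)
    then show ?thesis using False
      by (simp add: field_simps dot_square_norm)
  qed
  have orth: "u \<bullet> f w = 0" if w: "w \<in> V" "w \<bullet> u = 0" for w
  proof (rule quadratic_nonpos_imp_linear_zero)
    fix e :: real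
    have "u + e *\<^sub>R w \<in> V" using w uu V(1) by (simp add: subspace_add subspace_scale)
    from le[OF this]
    have "k + e * (u \<bullet> f w) + e * (w \<bullet> f u) + e\<^sup>2 * (w \<bullet> f w) \<le> k * (1 + e\<^sup>2 * (w \<bullet> w))"
      using w uu
      by (simp add: linear_add[OF f] linear_cmul[OF f] inner_add inner_simps k_def[symmetric]
          inner_commute[of u w] power2_eq_square algebra_simps)
    moreover have "w \<bullet> f u = u \<bullet> f w" using sa[of w u] by (simp add: inner_commute)
    ultimately show "2 * e * (u \<bullet> f w) + e\<^sup>2 * (w \<bullet> f w - k * (w \<bullet> w)) \<le> 0"
      by (simp add: algebra_simps)
  qed
  \<comment> \<open>The residual lies in V and is orthogonal to u, so its squared norm equals f u .
    r = u . f r, which vanishes by the first-order condition.\<close>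
  let ?r = "f u - k *\<^sub>R u"
  have rV: "?r \<in> V" using V uu by (auto simp: subspace_diff subspace_scale)
  have ru: "?r \<bullet> u = 0"
    unfolding inner_diff_left inner_scaleR_left uu(1) by (simp add: k_def inner_commute)
  have ur: "u \<bullet> ?r = 0" using ru by (simp only: inner_commute)
  have "?r \<bullet> ?r = f u \<bullet> ?r - k * (u \<bullet> ?r)" by (simp only: inner_diff_left inner_scaleR_left)
  also have "\<dots> = f u \<bullet> ?r" unfolding ur by simp
  also have "\<dots> = u \<bullet> f ?r" by (rule sa)
  also have "\<dots> = 0" by (rule orth[OF rV ru])
  finally have "f u = k *\<^sub>R u" by simp
  then show ?thesis using that uu by blast
qed

text \<open>Induction on the dimension: one eigenvector u is split off, and self-adjointness makes
  the orthogonal complement of u in V invariant again.\<close>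

lemma selfadjoint_eigenbasis_subspace:
  fixes f :: "'a::euclidean_space \<Rightarrow> 'a"
  assumes f: "linear f" and sa: "\<And>x y. f x \<bullet> y = x \<bullet> f y"
    and V: "subspace V" "f ` V \<subseteq> V"
  shows "\<exists>B. B \<subseteq> V \<and> finite B \<and> pairwise orthogonal B \<and> (\<forall>u\<in>B. norm u = 1 \<and> (\<exists>k. f u = k *\<^sub>R u))
     \<and> V \<subseteq> span B"
  using V
proof (induction "dim V" arbitrary: V rule: less_induct)
  case less
  show ?case
  proof (cases "V = {0}")
    case True
    then show ?thesis by (intro exI[of _ "{}"]) auto
  next
    case False
    obtain u k where u: "u \<in> V" "norm u = 1" "f u = k *\<^sub>R u"
      using selfadjoint_eigenvector[OF f sa less.prems False] by blast
    have uu: "u \<bullet> u = 1" using u by (simp add: norm_eq_1)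
    define W where "W = V \<inter> {w. u \<bullet> w = 0}"
    have W: "subspace W" unfolding W_def
      by (intro subspace_inter less.prems subspace_hyperplane)
    have fW: "f ` W \<subseteq> W"
    proof
      fix y assume "y \<in> f ` W"
      then obtain w where w: "w \<in> V" "u \<bullet> w = 0" "y = f w" by (auto simp: W_def)
      then have "u \<bullet> y = 0" using sa[of u w] by (simp add: u(3))
      then show "y \<in> W" using w less.prems by (auto simp: W_def)
    qed
    have "u \<notin> W" using uu by (simp add: W_def)
    then have "W \<subset> V" using u W_def by blast
    then have "dim W < dim V"
      using W less.prems by (metis dim_psubset span_eq_iff)
    from less.hyps[OF this W fW] obtain B where
      B: "B \<subseteq> W" "finite B" "pairwise orthogonal B" "\<forall>u\<in>B. norm u = 1 \<and> (\<exists>k. f u = k *\<^sub>R u)" "W \<subseteq> span B"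
      by blast
    have "V \<subseteq> span (insert u B)"
    proof
      fix v assume v: "v \<in> V"
      have "v - (u \<bullet> v) *\<^sub>R u \<in> W" using v u uu less.prems
        by (auto simp: W_def inner_diff_right intro!: subspace_diff subspace_scale)
      then show "v \<in> span (insert u B)" using B(5) span_breakdown_eq by blast
    qed
    moreover have "pairwise orthogonal (insert u B)"
      using B(1,3) by (auto simp: pairwise_insert W_def orthogonal_def inner_commute)
    ultimately show ?thesis
      using B u by (intro exI[of _ "insert u B"]) (auto simp: W_def)
  qed
qed

lemma selfadjoint_eigenbasis:
  fixes f :: "real^'n \<Rightarrow> real^'n"
  assumes f: "linear f" and sa: "\<And>x y. f x \<bullet> y = x \<bullet> f y"
  shows "\<exists>(u :: 'n \<Rightarrow> real^'n) k. (\<forall>i j. u i \<bullet> u j = (if i = j then 1 else 0)) \<and> (\<forall>i. f (u i) = k i *\<^sub>R u i)"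
proof -
  obtain B where B: "finite B" "pairwise orthogonal B"
    "\<forall>u\<in>B. norm u = 1 \<and> (\<exists>k. f u = k *\<^sub>R u)" "UNIV \<subseteq> span B"
    using selfadjoint_eigenbasis_subspace[OF f sa, of UNIV] by auto
  have "0 \<notin> B" using B(3) by fastforce
  then have "independent B" using B(2) pairwise_orthogonal_independent by blast
  then have "card B = CARD('n)"
    using B(4) by (metis DIM_cart DIM_real basis_card_eq_dim dim_UNIV mult.right_neutral top_greatest)
  then obtain u :: "'n \<Rightarrow> real^'n" where u: "bij_betw u UNIV B"
    using finite_same_card_bij[of "UNIV :: 'n set" B] B(1) by auto
  have uB: "u i \<in> B" for i using u by (auto simp: bij_betw_def)
  have inj: "inj u" using u by (auto simp: bij_betw_def)
  have "\<forall>i. \<exists>k. f (u i) = k *\<^sub>R u i" using B(3) uB by blast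
  then obtain k where k: "\<And>i. f (u i) = k i *\<^sub>R u i" by metis
  have "u i \<bullet> u j = (if i = j then 1 else 0)" for i j
  proof (cases "i = j")
    case True
    have "norm (u i) = 1" using B(3) uB by blast
    with True show ?thesis by (simp add: norm_eq_1)
  next
    case False
    then have "u i \<noteq> u j" using inj by (auto dest: injD)
    then show ?thesis using False B(2) uB by (auto simp: pairwise_def orthogonal_def)
  qed
  with k show ?thesis by blast
qed

lemma orthonormal_columns_orthogonal_matrix:
  fixes u :: "'n \<Rightarrow> real^'n"
  assumes "\<And>i j. u i \<bullet> u j = (if i = j then 1 else 0)"
  shows "orthogonal_matrix (\<chi> i j. u j $ i)"
proof -
  have "(\<Sum>k\<in>UNIV. u i $ k * u j $ k) = (if i = j then 1 else 0)" for i j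
    using assms[of i j] by (simp only: inner_vec_def inner_real_def)
  then show ?thesis
    unfolding orthogonal_matrix by (simp add: matrix_matrix_mult_def transpose_def mat_def vec_eq_iff)
qed

section \<open>Diagonalization of symmetric matrices\<close>

definition diag_mat :: "('n \<Rightarrow> real) \<Rightarrow> real^'n^'n" where
  "diag_mat k = (\<chi> i j. if i = j then k i else 0)"

lemma diag_mat_mult: "diag_mat k ** diag_mat m = diag_mat (\<lambda>i. k i * m i)"
  by (auto simp: diag_mat_def matrix_matrix_mult_def vec_eq_iff if_distrib[of "\<lambda>x. x * _"] sum.delta cong: if_cong)

lemma diag_mat_mult_vec: "diag_mat k *v x = (\<chi> i. k i * x $ i)"
  by (auto simp: diag_mat_def matrix_vector_mult_def vec_eq_iff if_distrib[of "\<lambda>x. x * _"] sum.delta cong: if_cong)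

lemma transpose_diag_mat [simp]: "transpose (diag_mat k) = diag_mat k"
  by (auto simp: diag_mat_def transpose_def vec_eq_iff)

lemma det_diag_mat: "det (diag_mat k) = prod k UNIV"
  by (subst det_diagonal) (auto simp: diag_mat_def)

lemma symmetric_mat_inner: "symmetric_mat A \<Longrightarrow> (A *v x) \<bullet> y = x \<bullet> (A *v y)"
  by (metis dot_lmul_matrix symmetric_mat_def transpose_matrix_vector)

lemma symmetric_mat_diagonalize:
  assumes A: "symmetric_mat (A :: real^'n^'n)"
  obtains Q k where "orthogonal_matrix Q" "A = Q ** diag_mat k ** transpose Q"
proof -
  obtain u :: "'n \<Rightarrow> real^'n" and k :: "'n \<Rightarrow> real"
    where u: "\<And>i j. u i \<bullet> u j = (if i = j then 1 else 0)" "\<And>i. A *v u i = k i *\<^sub>R u i"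
    using selfadjoint_eigenbasis[OF matrix_vector_mul_linear[of A] symmetric_mat_inner[OF A]] by blast
  define Q :: "real^'n^'n" where "Q = (\<chi> i j. u j $ i)"
  have Q: "orthogonal_matrix Q" unfolding Q_def by (rule orthonormal_columns_orthogonal_matrix[OF u(1)])
  have "A ** Q = Q ** diag_mat k"
  proof -
    have "(A ** Q) $ i $ j = (A *v u j) $ i" for i j
      by (simp add: Q_def matrix_matrix_mult_def matrix_vector_mult_def)
    moreover have "(Q ** diag_mat k) $ i $ j = u j $ i * k j" for i j
      by (simp add: Q_def matrix_matrix_mult_def diag_mat_def if_distrib[of "\<lambda>x. _ * x"] sum.delta cong: if_cong)
    ultimately show ?thesis by (simp add: vec_eq_iff u(2) mult.commute)
  qed
  then have "A = Q ** diag_mat k ** transpose Q"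
    using Q by (metis matrix_mul_assoc matrix_mul_rid orthogonal_matrix_def)
  with Q show ?thesis using that by blast
qed

text \<open>In the coordinates y = Q^T x the quadratic form is the sum of k_i y_i^2; the vector Q
  e_j isolates k_j.\<close>

lemma pos_def_mat_conj_diag:
  assumes Q: "orthogonal_matrix (Q :: real^'n^'n)"
  shows "pos_def_mat (Q ** diag_mat k ** transpose Q) \<longleftrightarrow> (\<forall>i. k i > 0)"
proof -
  have ip: "x \<bullet> ((Q ** diag_mat k ** transpose Q) *v x) = (\<Sum>i\<in>UNIV. k i * ((transpose Q *v x) $ i)\<^sup>2)" for x
  proof -
    have "x \<bullet> ((Q ** diag_mat k ** transpose Q) *v x) = x \<bullet> (Q *v (diag_mat k *v (transpose Q *v x)))"
      by (simp only: matrix_vector_mul_assoc matrix_mul_assoc)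
    also have "\<dots> = (transpose Q *v x) \<bullet> (diag_mat k *v (transpose Q *v x))"
      by (simp add: dot_lmul_matrix)
    also have "\<dots> = (\<Sum>i\<in>UNIV. k i * ((transpose Q *v x) $ i)\<^sup>2)"
      by (simp add: diag_mat_mult_vec inner_vec_def power2_eq_square algebra_simps)
    finally show ?thesis .
  qed
  have QQ: "transpose Q ** Q = mat 1" "Q ** transpose Q = mat 1" using Q by (auto simp: orthogonal_matrix_def)
  show ?thesis
  proof
    assume pd: "pos_def_mat (Q ** diag_mat k ** transpose Q)"
    show "\<forall>i. k i > 0"
    proof
      fix j
      define x where "x = Q *v axis j 1"
      have tx: "transpose Q *v x = axis j 1" by (simp add: x_def matrix_vector_mul_assoc QQ)
      then have "x \<noteq> 0" by (metis axis_eq_0_iff matrix_vector_mult_0_right zero_neq_one)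
      with pd have "0 < (\<Sum>i\<in>UNIV. k i * (axis j 1 $ i)\<^sup>2)"
        unfolding pos_def_mat_def ip tx by (metis tx)
      also have "\<dots> = k j"
        by (simp add: axis_def if_distrib[of "\<lambda>x. x^2"] if_distrib[of "\<lambda>x. _ * x"] sum.delta cong: if_cong)
      finally show "k j > 0" .
    qed
  next
    assume k: "\<forall>i. k i > 0"
    show "pos_def_mat (Q ** diag_mat k ** transpose Q)"
      unfolding pos_def_mat_def ip
    proof (intro allI impI)
      fix x :: "real^'n" assume "x \<noteq> 0"
      then have "transpose Q *v x \<noteq> 0"
        by (metis QQ(2) matrix_vector_mul_assoc matrix_vector_mul_lid matrix_vector_mult_0_right)
      then obtain j where "(transpose Q *v x) $ j \<noteq> 0" by (auto simp: vec_eq_iff)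
      then show "0 < (\<Sum>i\<in>UNIV. k i * ((transpose Q *v x) $ i)\<^sup>2)"
        using k by (intro sum_pos2[of _ j]) (auto intro!: mult_nonneg_nonneg simp: less_imp_le)
    qed
  qed
qed

text \<open>The two roots are compared on an eigenbasis of S. If S w = k w and z = S' w - k w, then
  (S' + k) z = (S'^2 - k^2) w = 0, and since S' + k is positive definite, z = 0. With existence this
  gives the \<open>THE\<close> in \<open>psd_sqrt\<close> its meaning.\<close>

lemma psd_sqrt_unique:
  fixes S S' :: "real^'n^'n"
  assumes S: "symmetric_mat S" "pos_def_mat S" and S': "symmetric_mat S'" "pos_def_mat S'"
    and eq: "S ** S = S' ** S'"
  shows "S = S'"
proof -
  obtain Q k where Q: "orthogonal_matrix Q" and SQ: "S = Q ** diag_mat k ** transpose Q"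
    using symmetric_mat_diagonalize[OF S(1)] by blast
  have k: "k i > 0" for i using S(2) pos_def_mat_conj_diag[OF Q] unfolding SQ by blast
  have QQ: "transpose Q ** Q = mat 1" "Q ** transpose Q = mat 1" using Q by (auto simp: orthogonal_matrix_def)
  have ev: "S' *v (Q *v axis i 1) = S *v (Q *v axis i 1)" for i
  proof -
    define w where "w = Q *v axis i 1"
    have Sw: "S *v w = k i *\<^sub>R w"
    proof -
      have "S *v w = Q *v (diag_mat k *v ((transpose Q ** Q) *v axis i 1))"
        by (simp add: SQ w_def matrix_vector_mul_assoc matrix_mul_assoc)
      also have "\<dots> = Q *v (k i *\<^sub>R axis i 1)"
        by (simp add: QQ diag_mat_mult_vec) (rule arg_cong[where f="\<lambda>x. Q *v x"], auto simp: vec_eq_iff axis_def)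
      finally show ?thesis by (simp add: w_def scaleR_matrix_vector_assoc matrix_vector_mult_scaleR)
    qed
    define z where "z = S' *v w - k i *\<^sub>R w"
    have "S' *v z + k i *\<^sub>R z = (S' ** S') *v w - (k i * k i) *\<^sub>R w"
      by (simp add: z_def matrix_vector_mult_diff_distrib matrix_vector_mul_assoc matrix_vector_mult_scaleR algebra_simps)
    also have "\<dots> = 0"
      by (simp add: eq[symmetric] matrix_vector_mul_assoc[symmetric] Sw matrix_vector_mult_scaleR)
    finally have "z \<bullet> (S' *v z) + k i * (z \<bullet> z) = 0"
      by (metis inner_add_right inner_scaleR_right inner_zero_right)
    moreover have "z \<bullet> (S' *v z) > 0" if "z \<noteq> 0" using S'(2) that by (auto simp: pos_def_mat_def)
    ultimately have "z = 0" using k[of i] by (smt (verit) inner_ge_zero mult_nonneg_nonneg)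
    then show ?thesis by (simp add: z_def Sw w_def[symmetric])
  qed
  have "S' ** Q = S ** Q"
  proof (rule matrix_eq[THEN iffD2], rule allI)
    fix x
    have "linear (\<lambda>x. (S' ** Q) *v x)" "linear (\<lambda>x. (S ** Q) *v x)" by simp_all
    then show "(S' ** Q) *v x = (S ** Q) *v x"
      by (rule linear_eq_stdbasis[THEN fun_cong])
         (auto simp: Basis_vec_def matrix_vector_mul_assoc[symmetric] ev)
  qed
  then show ?thesis by (metis QQ(2) matrix_mul_assoc matrix_mul_rid)
qed

lemma psd_sqrt_exists:
  fixes A :: "real^'n^'n"
  assumes A: "symmetric_mat A" "pos_def_mat A"
  shows "\<exists>S. symmetric_mat S \<and> pos_def_mat S \<and> S ** S = A"
proof -
  obtain Q k where Q: "orthogonal_matrix Q" and AQ: "A = Q ** diag_mat k ** transpose Q"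
    using symmetric_mat_diagonalize[OF A(1)] by blast
  have k: "k i > 0" for i using A(2) pos_def_mat_conj_diag[OF Q] unfolding AQ by blast
  have QQ: "transpose Q ** Q = mat 1" using Q by (auto simp: orthogonal_matrix_def)
  define S where "S = Q ** diag_mat (\<lambda>i. sqrt (k i)) ** transpose Q"
  have "S ** S = Q ** diag_mat (\<lambda>i. sqrt (k i)) ** (transpose Q ** Q) ** diag_mat (\<lambda>i. sqrt (k i)) ** transpose Q"
    by (simp add: S_def matrix_mul_assoc)
  also have "\<dots> = Q ** (diag_mat (\<lambda>i. sqrt (k i)) ** diag_mat (\<lambda>i. sqrt (k i))) ** transpose Q"
    by (simp only: QQ matrix_mul_rid matrix_mul_assoc)
  also have "\<dots> = A" using k by (simp add: diag_mat_mult AQ less_imp_le)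
  finally have "S ** S = A" .
  moreover have "pos_def_mat S" unfolding S_def pos_def_mat_conj_diag[OF Q] using k by simp
  moreover have "symmetric_mat S" by (simp add: S_def symmetric_mat_def matrix_transpose_mul matrix_mul_assoc)
  ultimately show ?thesis by blast
qed

lemma psd_sqrt:
  fixes A :: "real^'n^'n"
  assumes "symmetric_mat A" "pos_def_mat A"
  shows "symmetric_mat (psd_sqrt A)" "pos_def_mat (psd_sqrt A)" "psd_sqrt A ** psd_sqrt A = A"
proof -
  have "\<exists>!S. symmetric_mat S \<and> pos_def_mat S \<and> S ** S = A"
    using psd_sqrt_exists[OF assms] psd_sqrt_unique by blast
  from theI'[OF this] show "symmetric_mat (psd_sqrt A)" "pos_def_mat (psd_sqrt A)" "psd_sqrt A ** psd_sqrt A = A"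
    by (auto simp: psd_sqrt_def)
qed

lemma pos_def_mat_det_pos:
  fixes A :: "real^'n^'n"
  assumes "symmetric_mat A" "pos_def_mat A"
  shows "det A > 0"
proof -
  obtain Q k where Q: "orthogonal_matrix Q" and AQ: "A = Q ** diag_mat k ** transpose Q"
    using symmetric_mat_diagonalize[OF assms(1)] by blast
  have k: "k i > 0" for i using assms(2) pos_def_mat_conj_diag[OF Q] unfolding AQ by blast
  have "det Q * det Q = 1" using det_orthogonal_matrix[OF Q] by auto
  then have "det A = prod k UNIV"
    by (simp add: AQ det_mul det_diag_mat)
  then show ?thesis using k by (simp add: prod_pos)
qed

text \<open>\<open>inv_sqrt A\<close> is the root of the inverse, not the inverse of the root. For
  the determinants this makes no difference: the square of their product is det (A^-1 A) = 1, and
  both are positive.\<close>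

lemma inv_sqrt:
  fixes A :: "real^'n^'n"
  assumes A: "symmetric_mat A" "pos_def_mat A"
  shows "symmetric_mat (inv_sqrt A)" "pos_def_mat (inv_sqrt A)"
    "det (inv_sqrt A) = 1 / det (psd_sqrt A)"
proof -
  have d: "det A > 0" by (rule pos_def_mat_det_pos[OF A])
  then have inv: "A ** matrix_inv A = mat 1" "matrix_inv A ** A = mat 1"
  proof -
    from d have "\<exists>A'. A ** A' = mat 1 \<and> A' ** A = mat 1"
      using invertible_det_nz[of A] unfolding invertible_def by simp
    from someI_ex[OF this] show "A ** matrix_inv A = mat 1" "matrix_inv A ** A = mat 1"
      unfolding matrix_inv_def by blast+
  qed
  have sym: "symmetric_mat (matrix_inv A)"
  proof -
    have "transpose (matrix_inv A) ** A = mat 1"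
      using arg_cong[OF inv(1), of transpose] A(1) by (simp add: matrix_transpose_mul symmetric_mat_def)
    then show ?thesis unfolding symmetric_mat_def
      by (metis inv(1) matrix_mul_assoc matrix_mul_lid matrix_mul_rid)
  qed
  have pd: "pos_def_mat (matrix_inv A)"
    unfolding pos_def_mat_def
  proof (intro allI impI)
    fix x :: "real^'n" assume x: "x \<noteq> 0"
    define y where "y = matrix_inv A *v x"
    have xy: "x = A *v y" by (simp add: y_def matrix_vector_mul_assoc inv)
    with x have "y \<noteq> 0" by (auto simp: matrix_vector_mult_0_right)
    then show "0 < x \<bullet> (matrix_inv A *v x)"
      using A(2) by (simp add: y_def[symmetric] pos_def_mat_def) (simp add: xy inner_commute)
  qed
  note R = psd_sqrt[OF sym pd, folded inv_sqrt_def] and S = psd_sqrt[OF A]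
  show "symmetric_mat (inv_sqrt A)" "pos_def_mat (inv_sqrt A)" by (rule R)+
  have "(det (inv_sqrt A) * det (psd_sqrt A))\<^sup>2 = det (matrix_inv A ** A)"
    unfolding det_mul R(3)[symmetric]
    by (subst (3) S(3)[symmetric]) (simp add: det_mul power2_eq_square)
  then have "(det (inv_sqrt A) * det (psd_sqrt A))\<^sup>2 = 1" by (simp add: inv)
  moreover have pos: "det (inv_sqrt A) > 0" "det (psd_sqrt A) > 0"
    using pos_def_mat_det_pos R S by blast+
  then have "det (inv_sqrt A) * det (psd_sqrt A) > 0" by simp
  ultimately have "det (inv_sqrt A) * det (psd_sqrt A) = 1"
    using power2_eq_1_iff[of "det (inv_sqrt A) * det (psd_sqrt A)"] by linarith
  then show "det (inv_sqrt A) = 1 / det (psd_sqrt A)"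
    using pos by (simp add: eq_divide_eq)
qed

section \<open>Gaussian integrals and linear changes of variables\<close>

lemma nn_integral_lborel_translate:
  fixes f :: "'a::euclidean_space \<Rightarrow> ennreal"
  assumes [measurable]: "f \<in> borel_measurable borel"
  shows "(\<integral>\<^sup>+x. f (a + x) \<partial>lborel) = (\<integral>\<^sup>+x. f x \<partial>lborel)"
  by (subst (2) lborel_distr_plus[of a, symmetric]) (simp add: nn_integral_distr)

lemma lborel_distr_reflect:
  fixes a :: "'a::euclidean_space"
  shows "distr lborel borel (\<lambda>x. a - x) = lborel"
  by (subst (2) lborel_affine[of "-1" a]) (auto simp: density_1)

lemma nn_integral_lborel_reflect:
  fixes f :: "'a::euclidean_space \<Rightarrow> ennreal"
  assumes [measurable]: "f \<in> borel_measurable borel"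
  shows "(\<integral>\<^sup>+x. f (a - x) \<partial>lborel) = (\<integral>\<^sup>+x. f x \<partial>lborel)"
  by (subst (2) lborel_distr_reflect[of a, symmetric]) (simp add: nn_integral_distr)

lemma integral_lborel_reflect:
  fixes f :: "'a::euclidean_space \<Rightarrow> 'b::{banach,second_countable_topology}"
  assumes [measurable]: "f \<in> borel_measurable borel"
  shows "integral\<^sup>L lborel (\<lambda>x. f (a - x)) = integral\<^sup>L lborel f"
  by (subst (2) lborel_distr_reflect[of a, symmetric]) (simp add: integral_distr)

lemma integrable_lborel_reflect:
  fixes f :: "'a::euclidean_space \<Rightarrow> 'b::{banach,second_countable_topology}"
  assumes f: "integrable lborel f"
  shows "integrable lborel (\<lambda>x. f (a - x))"
proof -
  have [measurable]: "f \<in> borel_measurable borel" using f by auto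
  show ?thesis
    using f by (subst (asm) lborel_distr_reflect[of a, symmetric]) (simp add: integrable_distr_eq)
qed

text \<open>The substitution a r^2 in Euler's integral for Gamma((q + 1)/2) gives the half line, and
  evenness doubles it. This is where the Gamma factor of the sharp constant originates.\<close>

lemma nn_integral_abs_moment_gaussian:
  fixes q a :: real
  assumes q: "q \<ge> 0" and a: "a > 0"
  shows "(\<integral>\<^sup>+r. ennreal (\<bar>r\<bar> powr q) * ennreal (exp (- (a * r\<^sup>2))) \<partial>lborel)
     = ennreal (Gamma ((q + 1) / 2) / a powr ((q + 1) / 2))"
proof -
  define s where "s = (q + 1) / 2"
  have s: "s > 0" using q by (simp add: s_def)
  define F where "F r = ennreal (\<bar>r\<bar> powr q) * ennreal (exp (- (a * r\<^sup>2)))" for r :: real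
  have [measurable]: "F \<in> borel_measurable borel" by (simp add: F_def[abs_def])
  let ?f = "\<lambda>t::real. t powr (s - 1) / exp t"
  let ?g = "\<lambda>r::real. a * r\<^sup>2"
  have img: "?g ` {0<..} = {0<..}"
  proof (intro equalityI subsetI)
    fix y :: real assume "y \<in> {0<..}"
    then show "y \<in> ?g ` {0<..}"
      using a by (intro image_eqI[of _ _ "sqrt (y / a)"]) auto
  qed (use a in auto)
  have inj: "inj_on ?g {0<..}" using a by (auto simp: inj_on_def)
  have f: "(?f has_integral Gamma s) {0<..}"
    using Gamma_integral_real[OF s]
    by (rule has_integral_spike_set_eq[THEN iffD1, rotated 2]) (auto intro: negligible_subset[of "{0}"])
  then have "?f absolutely_integrable_on {0<..} \<and> integral {0<..} ?f = Gamma s"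
    by (auto simp: absolutely_integrable_on_iff_nonneg)
  moreover have "(?g has_real_derivative 2 * a * r) (at r within {0<..})" for r
    by (auto intro!: derivative_eq_intros)
  ultimately have "(\<lambda>r. \<bar>2 * a * r\<bar> * ?f (?g r)) absolutely_integrable_on {0<..} \<and>
      integral {0<..} (\<lambda>r. \<bar>2 * a * r\<bar> * ?f (?g r)) = Gamma s"
    using has_absolute_integral_change_of_variables_1'[of "{0<..}" ?g "\<lambda>r. 2 * a * r" ?f "Gamma s", unfolded img]
      inj by simp
  then have hi: "((\<lambda>r. \<bar>2 * a * r\<bar> * ?f (?g r)) has_integral Gamma s) {0<..}"
    by (metis (lifting) has_integral_iff set_lebesgue_integral_eq_integral(1))
  have eq: "ennreal (\<bar>2 * a * r\<bar> * ?f (?g r)) = ennreal (2 * a powr s) * F r" if "r > 0" for r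
  proof -
    have "r powr q = r powr (2 * (s - 1)) * r"
      using that powr_add[of r "2 * (s - 1)" 1] by (simp add: s_def field_simps)
    also have "r powr (2 * (s - 1)) = (r\<^sup>2) powr (s - 1)"
      using that powr_powr[of r 2 "s - 1"] by simp
    finally have rq: "r powr q = (r\<^sup>2) powr (s - 1) * r" .
    have aa: "a powr s = a powr (s - 1) * a" using a powr_add[of a "s - 1" 1] by simp
    have "\<bar>2 * a * r\<bar> * ?f (?g r) = 2 * a powr s * (\<bar>r\<bar> powr q * exp (- (a * r\<^sup>2)))"
      using that a by (simp add: rq aa powr_mult exp_minus field_simps)
    then show ?thesis unfolding F_def by (simp only: ennreal_mult' powr_ge_zero zero_le_mult_iff zero_le_numeral simp_thms mult.assoc)
  qed
  have "ennreal (Gamma s) = (\<integral>\<^sup>+r. ennreal (\<bar>2 * a * r\<bar> * ?f (?g r)) * indicator {0<..} r \<partial>lborel)"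
    by (rule nn_integral_has_integral_lebesgue'[symmetric, OF _ hi]) simp
  also have "\<dots> = (\<integral>\<^sup>+r. ennreal (2 * a powr s) * (F r * indicator {0<..} r) \<partial>lborel)"
    by (intro nn_integral_cong) (use eq in \<open>auto simp: indicator_def simp del: ennreal_mult''\<close>)
  also have "\<dots> = ennreal (2 * a powr s) * (\<integral>\<^sup>+r. F r * indicator {0<..} r \<partial>lborel)"
    by (rule nn_integral_cmult) simp
  finally have half: "ennreal (Gamma s) = ennreal (2 * a powr s) * (\<integral>\<^sup>+r. F r * indicator {0<..} r \<partial>lborel)" .
  have neg: "(\<integral>\<^sup>+r. F r * indicator {..<0} r \<partial>lborel) = (\<integral>\<^sup>+r. F r * indicator {0<..} r \<partial>lborel)"
    using nn_integral_lborel_reflect[of "\<lambda>r. F r * indicator {0<..} r" 0, symmetric]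
    by (simp add: F_def indicator_def)
  have "(\<integral>\<^sup>+r. F r \<partial>lborel) = (\<integral>\<^sup>+r. F r * indicator {0<..} r + F r * indicator {..<0} r \<partial>lborel)"
    by (rule nn_integral_cong_AE, rule AE_mp[OF AE_lborel_singleton[of 0]]) (auto simp: indicator_def)
  also have "\<dots> = (\<integral>\<^sup>+r. F r * indicator {0<..} r \<partial>lborel) + (\<integral>\<^sup>+r. F r * indicator {..<0} r \<partial>lborel)"
    by (rule nn_integral_add) auto
  also have "\<dots> = 2 * (\<integral>\<^sup>+r. F r * indicator {0<..} r \<partial>lborel)" by (simp add: neg mult_2)
  finally have tot: "(\<integral>\<^sup>+r. F r \<partial>lborel) = 2 * (\<integral>\<^sup>+r. F r * indicator {0<..} r \<partial>lborel)" .
  have "ennreal (Gamma s) = ennreal (a powr s) * (\<integral>\<^sup>+r. F r \<partial>lborel)"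
    unfolding half tot by (simp add: ennreal_mult' ac_simps)
  then have "ennreal (1 / a powr s) * ennreal (Gamma s)
      = (ennreal (1 / a powr s) * ennreal (a powr s)) * (\<integral>\<^sup>+r. F r \<partial>lborel)"
    by (simp only: mult.assoc)
  also have "ennreal (1 / a powr s) * ennreal (a powr s) = 1"
    using a ennreal_mult'[of "1 / a powr s" "a powr s"] by simp
  finally show ?thesis
    using a ennreal_mult'[of "1 / a powr s" "Gamma s"] by (simp add: F_def s_def)
qed

lemma nn_integral_gaussian:
  fixes a :: real
  assumes a: "a > 0"
  shows "(\<integral>\<^sup>+r. ennreal (exp (- (a * r\<^sup>2))) \<partial>lborel) = ennreal (sqrt (pi / a))"
proof -
  have "(\<integral>\<^sup>+r. ennreal (exp (- (a * r\<^sup>2))) \<partial>lborel)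
      = (\<integral>\<^sup>+r. ennreal (\<bar>r\<bar> powr 0) * ennreal (exp (- (a * r\<^sup>2))) \<partial>lborel)"
    \<comment> \<open>\<open>0 powr 0\<close> is 0, so the two integrands differ at r = 0.\<close>
    by (rule nn_integral_cong_AE, rule AE_mp[OF AE_lborel_singleton[of 0]]) auto
  also have "\<dots> = ennreal (sqrt (pi / a))"
    using nn_integral_abs_moment_gaussian[of 0 a] a
    by (simp add: Gamma_one_half_real real_sqrt_divide powr_half_sqrt)
  finally show ?thesis .
qed

lemma ennreal_exp_norm_square:
  fixes z :: "'a::euclidean_space"
  shows "ennreal (exp (- (a * (norm z)\<^sup>2))) = (\<Prod>b\<in>Basis. ennreal (exp (- (a * (z \<bullet> b)\<^sup>2))))"
proof -
  have "(norm z)\<^sup>2 = (\<Sum>b\<in>Basis. (z \<bullet> b)\<^sup>2)"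
    unfolding power2_norm_eq_inner by (subst euclidean_inner) (simp add: power2_eq_square)
  then show ?thesis
    by (simp add: prod_ennreal exp_sum[symmetric] sum_distrib_left sum_negf)
qed

lemma nn_integral_gaussian_euclidean:
  assumes a: "a > 0"
  shows "(\<integral>\<^sup>+z. ennreal (exp (- (a * (norm (z :: 'a::euclidean_space))\<^sup>2))) \<partial>lborel) = ennreal (sqrt (pi / a) ^ DIM('a))"
proof -
  have "ennreal (exp (- (a * (norm z)\<^sup>2))) = (\<Prod>b\<in>Basis. ennreal (exp (- (a * (z \<bullet> b)\<^sup>2))))" for z :: 'a
    by (rule ennreal_exp_norm_square)
  then show ?thesis
    by (simp add: nn_integral_lborel_prod[where f="\<lambda>b r. ennreal (exp (- (a * r\<^sup>2)))"] nn_integral_gaussian[OF a]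
        ennreal_power a less_imp_le)
qed

text \<open>Uniqueness of translation-invariant measures, tested against a rotation-invariant
  function of finite nonzero mass, namely a Gaussian.\<close>

lemma nn_integral_lborel_orthogonal:
  fixes Q :: "'a::euclidean_space \<Rightarrow> 'a"
  assumes Q: "orthogonal_transformation Q" and f[measurable]: "f \<in> borel_measurable borel"
  shows "(\<integral>\<^sup>+x. f (Q x) \<partial>lborel) = (\<integral>\<^sup>+x. f x \<partial>lborel)"
proof -
  define g :: "'a \<Rightarrow> ennreal" where "g x = ennreal (exp (- (norm x)\<^sup>2))" for x
  define c where "c = (\<integral>\<^sup>+x. g x \<partial>lborel)"
  have c: "c \<noteq> 0" "c \<noteq> \<infinity>"
    using nn_integral_gaussian_euclidean[of 1, where 'a='a] by (auto simp: c_def g_def)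
  have [measurable]: "g \<in> borel_measurable borel" by (simp add: g_def[abs_def])
  have lin: "linear Q" using Q by (rule orthogonal_transformation_linear)
  then have [measurable]: "Q \<in> borel_measurable borel"
    by (intro borel_measurable_continuous_onI linear_continuous_on linear_conv_bounded_linear[THEN iffD1])
  have gQ: "g (Q x) = g x" for x
    by (simp add: g_def orthogonal_transformation_norm[OF Q])
  have "(\<integral>\<^sup>+x. f (Q x) \<partial>lborel) * c = (\<integral>\<^sup>+x. f (Q x) * (\<integral>\<^sup>+y. g (Q x + y) \<partial>lborel) \<partial>lborel)"
    by (simp add: nn_integral_lborel_translate nn_integral_multc c_def)
  also have "\<dots> = (\<integral>\<^sup>+x. (\<integral>\<^sup>+y. f (Q x) * g (Q x + y) \<partial>lborel) \<partial>lborel)"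
    by (simp add: nn_integral_cmult)
  also have "\<dots> = (\<integral>\<^sup>+y. (\<integral>\<^sup>+x. f (Q x) * g (Q x + y) \<partial>lborel) \<partial>lborel)"
    by (rule lborel_pair.Fubini') simp
  also have "\<dots> = (\<integral>\<^sup>+y. (\<integral>\<^sup>+x. f (Q x - y) * g x \<partial>lborel) \<partial>lborel)"
  proof (rule nn_integral_cong)
    fix y
    \<comment> \<open>Translating x by -z moves y out of the Gaussian and into f; the Gaussian then
      no longer sees Q, and the integral over y of f (Q x - y) does not see it either.\<close>
    obtain z where z: "y = Q z" using orthogonal_transformation_surj[OF Q] by (metis surjD)
    have "(\<integral>\<^sup>+x. f (Q x) * g (Q x + y) \<partial>lborel) = (\<integral>\<^sup>+x. f (Q (- z + x)) * g (Q (- z + x) + y) \<partial>lborel)"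
      by (subst nn_integral_lborel_translate[where f="\<lambda>x. f (Q x) * g (Q x + y)"]) simp_all
    also have "\<dots> = (\<integral>\<^sup>+x. f (Q x - y) * g x \<partial>lborel)"
      by (simp add: linear_diff[OF lin] z gQ)
    finally show "(\<integral>\<^sup>+x. f (Q x) * g (Q x + y) \<partial>lborel) = (\<integral>\<^sup>+x. f (Q x - y) * g x \<partial>lborel)" .
  qed
  also have "\<dots> = (\<integral>\<^sup>+x. (\<integral>\<^sup>+y. f (Q x - y) * g x \<partial>lborel) \<partial>lborel)"
    by (rule lborel_pair.Fubini') simp
  also have "\<dots> = (\<integral>\<^sup>+x. f x \<partial>lborel) * c"
    by (simp add: nn_integral_multc nn_integral_lborel_reflect nn_integral_cmult c_def)
  finally show ?thesis using c by (simp add: mult.commute[of _ c] ennreal_mult_cancel_left)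
qed

lemma orthogonal_matrix_transformation:
  "orthogonal_matrix (Q :: real^'n^'n) \<Longrightarrow> orthogonal_transformation (\<lambda>x. Q *v x)"
  using orthogonal_transformation_matrix[of "\<lambda>x. Q *v x"] by simp

lemma nn_integral_lborel_diag_mat:
  fixes f :: "real^'n \<Rightarrow> ennreal"
  assumes k: "\<And>i. k i > 0" and [measurable]: "f \<in> borel_measurable borel"
  shows "(\<integral>\<^sup>+x. f x \<partial>lborel) = ennreal (prod k UNIV) * (\<integral>\<^sup>+x. f (diag_mat k *v x) \<partial>lborel)"
proof -
  define c :: "real^'n \<Rightarrow> real" where "c j = j \<bullet> (diag_mat k *v j)" for j
  have c: "c (axis i 1) = k i" for i
    by (simp add: c_def diag_mat_mult_vec inner_axis inner_axis')
  have T: "(\<Sum>j\<in>Basis. (c j * (x \<bullet> j)) *\<^sub>R j) = diag_mat k *v x" for x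
  proof (rule euclidean_eqI)
    fix b :: "real^'n" assume "b \<in> Basis"
    moreover from this obtain i where "b = axis i 1" by (auto simp: Basis_vec_def)
    ultimately show "(\<Sum>j\<in>Basis. (c j * (x \<bullet> j)) *\<^sub>R j) \<bullet> b = (diag_mat k *v x) \<bullet> b"
      by (simp only: inner_sum_left_Basis) (simp add: c inner_axis diag_mat_mult_vec)
  qed
  have B: "(Basis :: (real^'n) set) = range (\<lambda>i. axis i 1)" by (auto simp: Basis_vec_def)
  have "(\<Prod>j\<in>Basis. \<bar>c j\<bar>) = prod k UNIV"
    unfolding B by (subst prod.reindex) (auto simp: inj_on_def axis_eq_axis c abs_of_pos[OF k])
  moreover have "lborel = density (distr lborel borel (\<lambda>x. 0 + (\<Sum>j\<in>Basis. (c j * (x \<bullet> j)) *\<^sub>R j))) (\<lambda>_. (\<Prod>j\<in>Basis. \<bar>c j\<bar>))"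
    by (rule lborel_affine_euclidean) (use k in \<open>auto simp: B c less_imp_neq[symmetric]\<close>)
  ultimately have eq: "lborel = density (distr lborel borel (\<lambda>x. diag_mat k *v x)) (\<lambda>_. prod k UNIV)"
    by (simp add: T)
  have [measurable]: "(\<lambda>x. diag_mat k *v x) \<in> borel_measurable borel"
    by (intro borel_measurable_continuous_onI continuous_intros)
  show ?thesis
    by (subst eq) (simp add: nn_integral_density nn_integral_distr nn_integral_cmult)
qed

text \<open>R is a rotation, a scaling of the axes and a rotation back; only the scaling changes
  volume, by the product of the k_i, which is det R.\<close>

lemma nn_integral_lborel_pos_def:
  fixes f :: "real^'n \<Rightarrow> ennreal"
  assumes R: "symmetric_mat R" "pos_def_mat R" and f[measurable]: "f \<in> borel_measurable borel"
  shows "(\<integral>\<^sup>+x. f x \<partial>lborel) = ennreal (det R) * (\<integral>\<^sup>+x. f (R *v x) \<partial>lborel)"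
proof -
  obtain Q k where Q: "orthogonal_matrix Q" and RQ: "R = Q ** diag_mat k ** transpose Q"
    using symmetric_mat_diagonalize[OF R(1)] by blast
  have k: "k i > 0" for i using R(2) pos_def_mat_conj_diag[OF Q] unfolding RQ by blast
  have "det Q * det Q = 1" using det_orthogonal_matrix[OF Q] by auto
  then have det: "det R = prod k UNIV" by (simp add: RQ det_mul det_diag_mat)
  have [measurable]: "(\<lambda>x. M *v x) \<in> borel_measurable borel" for M :: "real^'n^'n"
    by (intro borel_measurable_continuous_onI continuous_intros)
  have "(\<integral>\<^sup>+x. f (R *v x) \<partial>lborel) = (\<integral>\<^sup>+x. f (Q *v (diag_mat k *v (transpose Q *v x))) \<partial>lborel)"
    by (simp only: RQ matrix_vector_mul_assoc matrix_mul_assoc)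
  also have "\<dots> = (\<integral>\<^sup>+x. f (Q *v (diag_mat k *v x)) \<partial>lborel)"
    using Q by (intro nn_integral_lborel_orthogonal[where f="\<lambda>x. f (Q *v (diag_mat k *v x))"]
        orthogonal_matrix_transformation) auto
  finally have "ennreal (det R) * (\<integral>\<^sup>+x. f (R *v x) \<partial>lborel) = (\<integral>\<^sup>+x. f (Q *v x) \<partial>lborel)"
    by (subst nn_integral_lborel_diag_mat[OF k]) (auto simp: det)
  also have "\<dots> = (\<integral>\<^sup>+x. f x \<partial>lborel)"
    using Q by (intro nn_integral_lborel_orthogonal orthogonal_matrix_transformation) auto
  finally show ?thesis by simp
qed

text \<open>After a rotation the function of z . v depends on one coordinate only, and the integrand
  splits into a product over the coordinates. The n - 1 others contribute plain Gaussian
  integrals.\<close>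

lemma nn_integral_ridge_gaussian:
  fixes v :: "real^'n" and \<psi> :: "real \<Rightarrow> ennreal"
  assumes a: "a > 0" and [measurable]: "\<psi> \<in> borel_measurable borel"
  shows "(\<integral>\<^sup>+z. \<psi> (z \<bullet> v) * ennreal (exp (- (a * (norm z)\<^sup>2))) \<partial>lborel)
    = ennreal (sqrt (pi / a) ^ (CARD('n) - 1)) * (\<integral>\<^sup>+r. \<psi> (norm v * r) * ennreal (exp (- (a * r\<^sup>2))) \<partial>lborel)"
proof -
  obtain b :: "real^'n" where b: "b \<in> Basis" using nonempty_Basis by blast
  \<comment> \<open>Sending |v| b to v, instead of b to v / |v|, covers v = 0 as well.\<close>
  obtain Q where Q: "orthogonal_transformation Q" and Qb: "Q (norm v *\<^sub>R b) = v"
    using orthogonal_transformation_exists[of "norm v *\<^sub>R b" v] b by auto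
  define F where "F b' r = (if b' = b then \<psi> (norm v * r) else 1) * ennreal (exp (- (a * r\<^sup>2)))"
    for b' :: "real^'n" and r
  have [measurable]: "F b' \<in> borel_measurable borel" for b' by (simp add: F_def[abs_def])
  have F: "\<psi> (Q z \<bullet> v) * ennreal (exp (- (a * (norm (Q z))\<^sup>2))) = (\<Prod>b'\<in>Basis. F b' (z \<bullet> b'))" for z
  proof -
    have "Q z \<bullet> v = norm v * (z \<bullet> b)"
      using Q by (subst Qb[symmetric]) (simp add: orthogonal_transformation_def)
    moreover have "ennreal (exp (- (a * (norm z)\<^sup>2))) = (\<Prod>b\<in>Basis. ennreal (exp (- (a * (z \<bullet> b)\<^sup>2))))"
      by (rule ennreal_exp_norm_square)
    ultimately show ?thesis
      using b by (simp add: F_def prod.distrib orthogonal_transformation_norm[OF Q] prod.delta)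
  qed
  have "(\<integral>\<^sup>+z. \<psi> (z \<bullet> v) * ennreal (exp (- (a * (norm z)\<^sup>2))) \<partial>lborel)
     = (\<integral>\<^sup>+z. \<psi> (Q z \<bullet> v) * ennreal (exp (- (a * (norm (Q z))\<^sup>2))) \<partial>lborel)"
    by (rule nn_integral_lborel_orthogonal[OF Q, symmetric]) simp
  also have "\<dots> = (\<Prod>b'\<in>Basis. \<integral>\<^sup>+r. F b' r \<partial>lborel)"
    unfolding F by (rule nn_integral_lborel_prod) auto
  also have "\<dots> = (\<integral>\<^sup>+r. F b r \<partial>lborel) * (\<Prod>b'\<in>Basis - {b}. \<integral>\<^sup>+r. F b' r \<partial>lborel)"
    using b by (intro prod.remove) auto
  also have "(\<Prod>b'\<in>Basis - {b}. \<integral>\<^sup>+r. F b' r \<partial>lborel) = (\<Prod>b'\<in>Basis - {b}. ennreal (sqrt (pi / a)))"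
    by (intro prod.cong) (auto simp: F_def nn_integral_gaussian[OF a])
  also have "\<dots> = ennreal (sqrt (pi / a) ^ (CARD('n) - 1))"
    using b a by (simp add: card_Diff_singleton ennreal_power less_imp_le)
  finally show ?thesis by (simp add: F_def mult.commute)
qed

section \<open>Gradients of convolutions\<close>

lemma integrable_mult_bounded:
  fixes F :: "'a::euclidean_space \<Rightarrow> 'b::euclidean_space" and g :: "'a \<Rightarrow> real"
  assumes F: "integrable lborel F" and [measurable]: "g \<in> borel_measurable borel" and B: "\<And>z. \<bar>g z\<bar> \<le> B"
  shows "integrable lborel (\<lambda>z. g z *\<^sub>R F z)"
proof (rule Bochner_Integration.integrable_bound)
  show "integrable lborel (\<lambda>z. B *\<^sub>R F z)" using F by simp
  show "(\<lambda>z. g z *\<^sub>R F z) \<in> borel_measurable lborel" using F by measurable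
  have "0 \<le> B" using B[of 0] by linarith
  then show "AE z in lborel. norm (g z *\<^sub>R F z) \<le> norm (B *\<^sub>R F z)"
    using B by (auto intro!: mult_right_mono)
qed

text \<open>K may be singular, so reflection moves the variable a from K into g. There continuity
  gives the pointwise limit, and \<open>B * norm (K z)\<close> is a dominating function independent
  of a.\<close>

lemma continuous_convolution:
  fixes K :: "'a::euclidean_space \<Rightarrow> 'b::euclidean_space" and g :: "'a \<Rightarrow> real"
  assumes K: "integrable lborel K" and g: "continuous_on UNIV g" "\<And>z. \<bar>g z\<bar> \<le> B"
  shows "continuous_on UNIV (\<lambda>a. \<integral>z. g z *\<^sub>R K (a - z) \<partial>lborel)"
proof -
  have [measurable]: "g \<in> borel_measurable borel" using g(1) by (rule borel_measurable_continuous_onI)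
  have [measurable]: "K \<in> borel_measurable borel" using K by simp
  have eq: "(\<integral>z. g z *\<^sub>R K (a - z) \<partial>lborel) = (\<integral>z. g (a - z) *\<^sub>R K z \<partial>lborel)" for a
    using integral_lborel_reflect[of "\<lambda>z. g (a - z) *\<^sub>R K z" a] by simp
  have "continuous (at a) (\<lambda>a. \<integral>z. g (a - z) *\<^sub>R K z \<partial>lborel)" for a
    unfolding continuous_at_sequentially comp_def
  proof (intro allI impI)
    fix X assume X: "X \<longlonglongrightarrow> a"
    show "(\<lambda>n. \<integral>z. g (X n - z) *\<^sub>R K z \<partial>lborel) \<longlonglongrightarrow> (\<integral>z. g (a - z) *\<^sub>R K z \<partial>lborel)"
    proof (rule integral_dominated_convergence[where w="\<lambda>z. B * norm (K z)"])
      show "integrable lborel (\<lambda>z. B * norm (K z))" using K by simp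
      have "isCont g w" for w using g(1) by (simp add: continuous_on_eq_continuous_at)
      then show "AE z in lborel. (\<lambda>n. g (X n - z) *\<^sub>R K z) \<longlonglongrightarrow> g (a - z) *\<^sub>R K z"
        using X by (intro AE_I2 tendsto_intros isCont_tendsto_compose[of _ g])
      show "AE z in lborel. norm (g (X n - z) *\<^sub>R K z) \<le> B * norm (K z)" for n
        using g(2) by (auto intro!: mult_right_mono)
    qed simp_all
  qed
  then show ?thesis unfolding eq by (simp add: continuous_on_eq_continuous_at)
qed

context
  fixes G :: "'a::euclidean_space \<times> real \<Rightarrow> real" and K :: "'a \<times> real \<Rightarrow> 'a" and g :: "'a \<times> real \<Rightarrow> real"
    and B t :: real
  assumes G: "integrable lborel G" and K: "integrable lborel K"
    and deriv: "\<And>x s. ((\<lambda>x. G (x, s)) has_derivative (\<lambda>h. K (x, s) \<bullet> h)) (at x)"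
    and contK: "\<And>s. continuous_on UNIV (\<lambda>x. K (x, s))"
    and g: "continuous_on UNIV g" "\<And>z. \<bar>g z\<bar> \<le> B"
begin

text \<open>For each fixed z this is the fundamental theorem of calculus along the segment from y to
  y + h; the integrals over z and over the segment are then exchanged.\<close>

lemma convolution_increment:
  "(\<integral>z. G ((y + h, t) - z) * g z \<partial>lborel) - (\<integral>z. G ((y, t) - z) * g z \<partial>lborel)
   = (\<integral>\<theta>. indicator {0..1} \<theta> * ((\<integral>z. g z *\<^sub>R K ((y + \<theta> *\<^sub>R h, t) - z) \<partial>lborel) \<bullet> h) \<partial>lborel)"
proof -
  have [measurable]: "g \<in> borel_measurable borel" using g(1) by (rule borel_measurable_continuous_onI)
  have [measurable]: "K \<in> borel_measurable borel" "G \<in> borel_measurable borel" using K G by simp_all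
  have B: "0 \<le> B" using g(2)[of 0] by linarith
  define H where "H \<theta> z = indicator {0..1} \<theta> * ((K ((y + \<theta> *\<^sub>R h, t) - z) \<bullet> h) * g z)" for \<theta> :: real and z
  have Hm[measurable]: "case_prod H \<in> borel_measurable (lborel \<Otimes>\<^sub>M lborel)"
    unfolding H_def by measurable
  have Gi: "integrable lborel (\<lambda>z. G (a - z) * g z)" for a
    using integrable_mult_bounded[OF integrable_lborel_reflect[OF G, of a] _ g(2)]
    by (simp add: mult.commute)
  have Ki: "integrable lborel (\<lambda>z. g z *\<^sub>R K (a - z))" for a
    using integrable_mult_bounded[OF integrable_lborel_reflect[OF K, of a] _ g(2)] by simp
  have FTC: "G ((y + h, t) - z) * g z - G ((y, t) - z) * g z = (\<integral>\<theta>. H \<theta> z \<partial>lborel)" for z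
  proof -
    obtain w s where z: "z = (w, s)" by (cases z)
    define \<phi> where "\<phi> \<theta> = G ((y + \<theta> *\<^sub>R h, t) - z)" for \<theta> :: real
    have d: "(\<phi> has_real_derivative K ((y + \<theta> *\<^sub>R h, t) - z) \<bullet> h) (at \<theta>)" for \<theta>
    proof -
      have "((\<lambda>\<theta>. G (y + \<theta> *\<^sub>R h - w, t - s)) has_derivative (\<lambda>k. K (y + \<theta> *\<^sub>R h - w, t - s) \<bullet> (k *\<^sub>R h))) (at \<theta>)"
        by (rule has_derivative_compose[OF _ deriv]) (auto intro!: derivative_eq_intros)
      then show ?thesis
        unfolding has_field_derivative_def by (simp add: \<phi>_def[abs_def] z mult.commute[of _ "K _ \<bullet> h"])
    qed
    have "isCont (\<lambda>\<theta>. K ((y + \<theta> *\<^sub>R h, t) - z) \<bullet> h) \<theta>" for \<theta>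
    proof -
      have "continuous_on UNIV (\<lambda>\<theta>. K (y + \<theta> *\<^sub>R h - w, t - s) \<bullet> h)"
        by (intro continuous_intros continuous_on_compose2[OF contK]) auto
      then show ?thesis by (simp add: z continuous_on_eq_continuous_at)
    qed
    then have "(\<integral>\<theta>. (K ((y + \<theta> *\<^sub>R h, t) - z) \<bullet> h) * indicator {0..1} \<theta> \<partial>lborel) = \<phi> 1 - \<phi> 0"
      by (intro integral_FTC_Icc_real d) auto
    moreover have "(\<integral>\<theta>. H \<theta> z \<partial>lborel) = (\<integral>\<theta>. (K ((y + \<theta> *\<^sub>R h, t) - z) \<bullet> h) * indicator {0..1} \<theta> \<partial>lborel) * g z"
      unfolding H_def by (subst integral_mult_left_zero[symmetric]) (simp add: ac_simps)
    ultimately show ?thesis by (simp add: \<phi>_def left_diff_distrib[symmetric])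
  qed
  \<comment> \<open>For each theta the integral over z is at most |h| B times the L^1 norm of K,
    because that norm is unchanged by translation and reflection.\<close>
  have int: "integrable (lborel \<Otimes>\<^sub>M lborel) (case_prod H)"
  proof (rule integrableI_bounded)
    define C where "C = (\<integral>\<^sup>+z. ennreal (norm (K z)) \<partial>lborel)"
    have C: "C < \<infinity>" using K by (simp add: C_def integrable_iff_bounded)
    have "(\<integral>\<^sup>+\<omega>. ennreal (norm (case_prod H \<omega>)) \<partial>(lborel \<Otimes>\<^sub>M lborel))
        = (\<integral>\<^sup>+\<theta>. \<integral>\<^sup>+z. ennreal (norm (H \<theta> z)) \<partial>lborel \<partial>lborel)"
      using lborel.nn_integral_fst[of "\<lambda>\<omega>. ennreal (norm (case_prod H \<omega>))" lborel] by simp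
    also have "\<dots> \<le> (\<integral>\<^sup>+\<theta>. ennreal (norm h * B) * C * indicator {0..1::real} \<theta> \<partial>lborel)"
    proof (rule nn_integral_mono)
      fix \<theta> :: real
      have le: "norm (H \<theta> z) \<le> indicator {0..1} \<theta> * (norm h * B) * norm (K ((y + \<theta> *\<^sub>R h, t) - z))" for z
      proof -
        have "\<bar>K ((y + \<theta> *\<^sub>R h, t) - z) \<bullet> h\<bar> * \<bar>g z\<bar> \<le> (norm (K ((y + \<theta> *\<^sub>R h, t) - z)) * norm h) * B"
          using g(2) B by (intro mult_mono Cauchy_Schwarz_ineq2) auto
        then show ?thesis by (auto simp: H_def indicator_def abs_mult ac_simps)
      qed
      have "(\<integral>\<^sup>+z. ennreal (norm (H \<theta> z)) \<partial>lborel)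
        \<le> (\<integral>\<^sup>+z. ennreal (indicator {0..1} \<theta> * (norm h * B)) * ennreal (norm (K ((y + \<theta> *\<^sub>R h, t) - z))) \<partial>lborel)"
        using B by (intro nn_integral_mono) (subst ennreal_mult'[symmetric], simp, rule ennreal_leI[OF le])
      also have "\<dots> = ennreal (indicator {0..1} \<theta> * (norm h * B)) * C"
        by (simp add: nn_integral_cmult C_def nn_integral_lborel_reflect[where f="\<lambda>z. ennreal (norm (K z))"])
      also have "\<dots> = ennreal (norm h * B) * C * indicator {0..1::real} \<theta>"
        by (auto simp: indicator_def)
      finally show "(\<integral>\<^sup>+z. ennreal (norm (H \<theta> z)) \<partial>lborel) \<le> ennreal (norm h * B) * C * indicator {0..1::real} \<theta>" .
    qed
    also have "\<dots> = ennreal (norm h * B) * C"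
      by (subst nn_integral_cmult) auto
    also have "\<dots> < \<infinity>" using C by (simp add: ennreal_mult_less_top)
    finally show "(\<integral>\<^sup>+\<omega>. ennreal (norm (case_prod H \<omega>)) \<partial>(lborel \<Otimes>\<^sub>M lborel)) < \<infinity>" .
  qed (rule Hm)
  have "(\<integral>z. G ((y + h, t) - z) * g z \<partial>lborel) - (\<integral>z. G ((y, t) - z) * g z \<partial>lborel)
      = (\<integral>z. \<integral>\<theta>. H \<theta> z \<partial>lborel \<partial>lborel)"
    by (subst Bochner_Integration.integral_diff[symmetric, OF Gi Gi]) (simp add: FTC)
  also have "\<dots> = (\<integral>\<theta>. \<integral>z. H \<theta> z \<partial>lborel \<partial>lborel)"
    by (rule lborel_pair.Fubini_integral[OF int])
  also have "\<dots> = (\<integral>\<theta>. indicator {0..1} \<theta> * ((\<integral>z. g z *\<^sub>R K ((y + \<theta> *\<^sub>R h, t) - z) \<partial>lborel) \<bullet> h) \<partial>lborel)"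
  proof (rule Bochner_Integration.integral_cong)
    fix \<theta> :: real
    have "(\<integral>z. H \<theta> z \<partial>lborel) = indicator {0..1} \<theta> * (\<integral>z. (g z *\<^sub>R K ((y + \<theta> *\<^sub>R h, t) - z)) \<bullet> h \<partial>lborel)"
      unfolding H_def by (subst integral_mult_right_zero) (simp add: mult.commute)
    also have "(\<integral>z. (g z *\<^sub>R K ((y + \<theta> *\<^sub>R h, t) - z)) \<bullet> h \<partial>lborel) = (\<integral>z. g z *\<^sub>R K ((y + \<theta> *\<^sub>R h, t) - z) \<partial>lborel) \<bullet> h"
      by (rule integral_inner_left) (use Ki in auto)
    finally show "(\<integral>z. H \<theta> z \<partial>lborel) = indicator {0..1} \<theta> * ((\<integral>z. g z *\<^sub>R K ((y + \<theta> *\<^sub>R h, t) - z) \<partial>lborel) \<bullet> h)" .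
  qed simp
  finally show ?thesis .
qed

text \<open>By the increment formula the remainder is the average of (V(x + theta h) - V x) . h over
  theta in [0, 1], and it is small compared with |h| because V is continuous at x.\<close>

lemma convolution_has_derivative:
  "((\<lambda>y. \<integral>z. G ((y, t) - z) * g z \<partial>lborel) has_derivative
     (\<lambda>h. (\<integral>z. g z *\<^sub>R K ((x, t) - z) \<partial>lborel) \<bullet> h)) (at x)"
  unfolding has_derivative_at_alt
proof (intro conjI allI impI)
  define V where "V y = (\<integral>z. g z *\<^sub>R K ((y, t) - z) \<partial>lborel)" for y
  define F where "F y = (\<integral>z. G ((y, t) - z) * g z \<partial>lborel)" for y
  show "bounded_linear (\<lambda>h. (\<integral>z. g z *\<^sub>R K ((x, t) - z) \<partial>lborel) \<bullet> h)"
    by (rule bounded_linear_inner_right)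
  have cV: "continuous_on UNIV V"
    unfolding V_def by (rule continuous_on_compose2[OF continuous_convolution[OF K g]]) (auto intro!: continuous_intros)
  fix e :: real assume e: "e > 0"
  have "isCont V x" using cV by (simp add: continuous_on_eq_continuous_at)
  then obtain d where d: "d > 0" "\<And>y. norm (y - x) < d \<Longrightarrow> norm (V y - V x) < e"
    using e by (auto simp: continuous_at_eps_delta dist_norm)
  show "\<exists>d>0. \<forall>y. norm (y - x) < d \<longrightarrow>
      norm (F y - F x - V x \<bullet> (y - x)) \<le> e * norm (y - x)"
  proof (intro exI[of _ d] conjI allI impI)
    fix y assume y: "norm (y - x) < d"
    define h where "h = y - x"
    have ci: "set_integrable lborel {0..1} (\<lambda>\<theta>::real. (V (x + \<theta> *\<^sub>R h) - c) \<bullet> h)" for c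
      by (intro borel_integrable_atLeastAtMost' continuous_intros continuous_on_compose2[OF cV]) auto
    then have i: "integrable lborel (\<lambda>\<theta>::real. indicator {0..1} \<theta> * ((V (x + \<theta> *\<^sub>R h) - c) \<bullet> h))" for c
      unfolding set_integrable_def real_scaleR_def .
    have one: "integrable lborel (\<lambda>\<theta>::real. indicator {0..1} \<theta> :: real)"
       "(\<integral>\<theta>. indicator {0..1::real} \<theta> \<partial>lborel) = (1 :: real)" by auto
    have "F y - F x - V x \<bullet> h = (\<integral>\<theta>. indicator {0..1} \<theta> * (V (x + \<theta> *\<^sub>R h) \<bullet> h) \<partial>lborel)
       - (\<integral>\<theta>. indicator {0..1::real} \<theta> * (V x \<bullet> h) \<partial>lborel)"
      using convolution_increment[of x h] by (simp add: F_def V_def h_def)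
    also have "\<dots> = (\<integral>\<theta>. indicator {0..1} \<theta> * (V (x + \<theta> *\<^sub>R h) \<bullet> h) - indicator {0..1} \<theta> * (V x \<bullet> h) \<partial>lborel)"
      by (rule Bochner_Integration.integral_diff[symmetric]) (use i[of 0] one(1) in auto)
    also have "\<dots> = (\<integral>\<theta>. indicator {0..1} \<theta> * ((V (x + \<theta> *\<^sub>R h) - V x) \<bullet> h) \<partial>lborel)"
      by (simp add: inner_diff_left algebra_simps)
    finally have eq: "F y - F x - V x \<bullet> h = (\<integral>\<theta>. indicator {0..1} \<theta> * ((V (x + \<theta> *\<^sub>R h) - V x) \<bullet> h) \<partial>lborel)" .
    have "\<bar>\<integral>\<theta>. indicator {0..1} \<theta> * ((V (x + \<theta> *\<^sub>R h) - V x) \<bullet> h) \<partial>lborel\<bar>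
       \<le> (\<integral>\<theta>. indicator {0..1::real} \<theta> * (e * norm h) \<partial>lborel)"
    proof (rule integral_abs_bound_integral)
      fix \<theta> :: real
      have "\<bar>(V (x + \<theta> *\<^sub>R h) - V x) \<bullet> h\<bar> \<le> e * norm h" if "\<theta> \<in> {0..1}"
      proof -
        have "norm (\<theta> *\<^sub>R h) \<le> norm h" using that by (simp add: mult_left_le_one_le)
        then have "norm (V (x + \<theta> *\<^sub>R h) - V x) < e"
          using y by (intro d) (simp add: h_def)
        then show ?thesis
          by (intro order_trans[OF Cauchy_Schwarz_ineq2] mult_right_mono) auto
      qed
      then show "\<bar>indicator {0..1} \<theta> * ((V (x + \<theta> *\<^sub>R h) - V x) \<bullet> h)\<bar> \<le> indicator {0..1} \<theta> * (e * norm h)"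
        by (auto simp: indicator_def)
    qed (use i one in auto)
    also have "\<dots> = e * norm h" using one(2) by simp
    finally show "norm (F y - F x - V x \<bullet> (y - x)) \<le> e * norm (y - x)"
      unfolding h_def[symmetric] eq by simp
  qed (rule d)
qed

end

section \<open>The heat kernel and its gradient\<close>

text \<open>The gradient of the kernel in x. The root R = A^-1/2 is applied twice, in place of A^-1,
  so that by symmetry of R the pairing with l becomes (R (x + t b)) . (R l), a linear function of
  the Gaussian variable R (x + t b).\<close>

definition heat_grad :: "real^'n^'n \<Rightarrow> real^'n \<Rightarrow> real \<Rightarrow> real^'n \<Rightarrow> real \<Rightarrow> real^'n" where
  "heat_grad A b c x t = (- (1 / (2 * t)) * heat_kernel A b c x t) *\<^sub>R
     (inv_sqrt A *v (inv_sqrt A *v (x + t *\<^sub>R b)))"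

text \<open>What remains of the q-th power integral of the kernel's derivative at one time after the
  factor |A^-1/2 l|^q and the dependence on time are split off.\<close>

definition grad_const :: "real^'n^'n \<Rightarrow> real \<Rightarrow> real" where
  "grad_const A q = det (psd_sqrt A) powr (1 - q) * 2 powr (real CARD('n) * (1 - q)) *
     pi powr ((real CARD('n) - 1 - real CARD('n) * q) / 2) * (Gamma ((q + 1) / 2) / q powr ((real CARD('n) + q) / 2))"

lemma borel_measurable_matrix_vector_mult [measurable (raw)]:
  fixes M :: "real^'n^'m"
  shows "f \<in> borel_measurable N \<Longrightarrow> (\<lambda>x. M *v f x) \<in> borel_measurable N"
  by (rule measurable_compose[where f=f and g="\<lambda>x. M *v x"])
     (auto intro!: borel_measurable_continuous_onI continuous_intros)

lemma borel_measurable_heat_kernel [measurable]: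
  "(\<lambda>w. heat_kernel A b c (fst w) (snd w)) \<in> borel_measurable borel"
  unfolding heat_kernel_def borel_prod[symmetric] by measurable

lemma borel_measurable_heat_grad [measurable]:
  "(\<lambda>w. heat_grad A b c (fst w) (snd w)) \<in> borel_measurable borel"
  unfolding heat_grad_def heat_kernel_def borel_prod[symmetric] by measurable

lemma continuous_on_matrix_vector_mult [continuous_intros]:
  fixes M :: "real^'n^'m"
  shows "continuous_on S f \<Longrightarrow> continuous_on S (\<lambda>x. M *v f x)"
  by (rule bounded_linear.continuous_on[OF matrix_vector_mul_bounded_linear])

lemma continuous_heat_grad: "continuous_on UNIV (\<lambda>x. heat_grad A b c x s)"
  unfolding heat_grad_def heat_kernel_def by (intro continuous_intros)

context
  fixes A :: "real^'n^'n" and b :: "real^'n" and c :: real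
  assumes A: "symmetric_mat A" "pos_def_mat A"
begin

lemma inner_heat_grad:
  "heat_grad A b c x s \<bullet> l
   = - (1 / (2 * s)) * heat_kernel A b c x s * ((inv_sqrt A *v (x + s *\<^sub>R b)) \<bullet> (inv_sqrt A *v l))"
  using symmetric_mat_inner[OF inv_sqrt(1)[OF A], of "inv_sqrt A *v (x + s *\<^sub>R b)" l]
  by (simp add: heat_grad_def)

lemma heat_kernel_has_derivative:
  "((\<lambda>x. heat_kernel A b c x s) has_derivative (\<lambda>h. heat_grad A b c x s \<bullet> h)) (at x)"
proof -
  let ?R = "inv_sqrt A"
  have lin: "((\<lambda>x. ?R *v (x + s *\<^sub>R b)) has_derivative (\<lambda>h. ?R *v h)) (at x)"
    by (rule has_derivative_compose[where g="\<lambda>y. ?R *v y"])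
       (auto intro!: derivative_eq_intros bounded_linear.has_derivative[where f="\<lambda>y. ?R *v y"] matrix_vector_mul_bounded_linear)
  show ?thesis
    unfolding heat_kernel_def power2_norm_eq_inner
    apply (rule has_derivative_eq_rhs)
     apply (rule derivative_intros lin)+
    apply (rule ext)
    subgoal for h
      by (simp add: inner_heat_grad heat_kernel_def power2_norm_eq_inner field_simps
          inner_commute[of "?R *v h" "?R *v (x + s *\<^sub>R b)"])
    done
qed

lemma det_psd_sqrt_pos: "det (psd_sqrt A) > 0"
  using pos_def_mat_det_pos psd_sqrt[OF A] by blast

lemma nn_integral_inv_sqrt:
  assumes [measurable]: "f \<in> borel_measurable borel"
  shows "(\<integral>\<^sup>+z. f (inv_sqrt A *v (z + a)) \<partial>lborel) = ennreal (det (psd_sqrt A)) * (\<integral>\<^sup>+z. f z \<partial>lborel)"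
proof -
  have "(\<integral>\<^sup>+z. f (inv_sqrt A *v (z + a)) \<partial>lborel) = (\<integral>\<^sup>+z. f (inv_sqrt A *v z) \<partial>lborel)"
    using nn_integral_lborel_translate[of "\<lambda>z. f (inv_sqrt A *v z)" a] by (simp add: add.commute)
  also have "\<dots> = (ennreal (det (psd_sqrt A)) * ennreal (det (inv_sqrt A))) * (\<integral>\<^sup>+z. f (inv_sqrt A *v z) \<partial>lborel)"
    using det_psd_sqrt_pos by (simp add: inv_sqrt(3)[OF A] ennreal_mult'[symmetric] del: ennreal_mult'')
  also have "\<dots> = ennreal (det (psd_sqrt A)) * (\<integral>\<^sup>+z. f z \<partial>lborel)"
    by (subst nn_integral_lborel_pos_def[OF inv_sqrt(1,2)[OF A], of f]) (simp_all add: mult.assoc)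
  finally show ?thesis .
qed

lemma heat_kernel_nonneg: "s > 0 \<Longrightarrow> heat_kernel A b c x s \<ge> 0"
  using det_psd_sqrt_pos by (simp add: heat_kernel_def)

lemma nn_integral_heat_kernel:
  assumes s: "s > 0"
  shows "(\<integral>\<^sup>+z. ennreal (heat_kernel A b c z s) \<partial>lborel) = ennreal (exp (c * s))"
proof -
  let ?D = "det (psd_sqrt A)"
  let ?M = "exp (c * s) / ((2 * sqrt (pi * s)) ^ CARD('n) * ?D)"
  have sq: "sqrt (pi / (1 / (4 * s))) = 2 * sqrt (pi * s)" by (simp add: real_sqrt_mult)
  have D: "?D > 0" by (rule det_psd_sqrt_pos)
  have "(\<integral>\<^sup>+z. ennreal (heat_kernel A b c z s) \<partial>lborel)
     = ennreal ?M * (\<integral>\<^sup>+z. ennreal (exp (- (1 / (4 * s) * (norm (inv_sqrt A *v (z + s *\<^sub>R b)))\<^sup>2))) \<partial>lborel)"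
    using D s by (subst nn_integral_cmult[symmetric]) (auto simp: heat_kernel_def ennreal_mult'[symmetric] simp del: ennreal_mult'')
  also have "\<dots> = ennreal ?M * (ennreal ?D * ennreal (sqrt (pi / (1 / (4 * s))) ^ CARD('n)))"
    using s nn_integral_inv_sqrt[of "\<lambda>z. ennreal (exp (- (1 / (4 * s) * (norm z)\<^sup>2)))" "s *\<^sub>R b"]
        nn_integral_gaussian_euclidean[of "1 / (4 * s)", where 'a="real^'n"] by simp
  also have "\<dots> = ennreal (?M * (?D * (2 * sqrt (pi * s)) ^ CARD('n)))"
    using D s unfolding sq by (simp add: ennreal_mult'[symmetric] del: ennreal_mult'')
  also have "?M * (?D * (2 * sqrt (pi * s)) ^ CARD('n)) = exp (c * s)"
    using D s by simp
  finally show ?thesis .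
qed

lemma grad_const_pos: "q > 0 \<Longrightarrow> grad_const A q > 0"
  using det_psd_sqrt_pos by (simp add: grad_const_def Gamma_real_pos)

text \<open>The powers of s are s^-q from the factor 1/(2s), s^(-nq/2) from the normalization of the
  kernel, s^((n-1)/2) from the n - 1 Gaussian integrals and s^((q+1)/2) from the moment. Both sides
  are positive, so they are compared through their logarithms, in which the exponents enter
  linearly.\<close>

lemma grad_const_scaling:
  fixes q s :: real
  assumes q: "q > 0" and s: "s > 0"
  shows "(1 / (2 * s) * (exp (c * s) / ((2 * sqrt (pi * s)) ^ CARD('n) * det (psd_sqrt A)))) powr q
     * det (psd_sqrt A) * sqrt (pi / (q / (4 * s))) ^ (CARD('n) - 1)
     * (Gamma ((q + 1) / 2) / (q / (4 * s)) powr ((q + 1) / 2))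
    = grad_const A q * (exp (q * c * s) / s powr ((real CARD('n) * (q - 1) + q) / 2))"
proof -
  define D where "D = det (psd_sqrt A)"
  have D: "D > 0" unfolding D_def by (rule det_psd_sqrt_pos)
  define g where "g = Gamma ((q + 1) / 2)"
  have g: "g > 0" using q by (simp add: g_def Gamma_real_pos)
  obtain m where m: "CARD('n) = Suc m" using zero_less_card_finite[where 'a='n] by (cases "CARD('n)") auto
  have l4: "ln (4::real) = 2 * ln 2" using ln_realpow[of 2 2] by simp
  note pos = q s D g pi_gt_zero
  have "ln ((1 / (2 * s) * (exp (c * s) / ((2 * sqrt (pi * s)) ^ CARD('n) * D))) powr q
     * D * sqrt (pi / (q / (4 * s))) ^ (CARD('n) - 1) * (g / (q / (4 * s)) powr ((q + 1) / 2)))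
    = ln (D powr (1 - q) * 2 powr (real CARD('n) * (1 - q)) *
     pi powr ((real CARD('n) - 1 - real CARD('n) * q) / 2) * (g / q powr ((real CARD('n) + q) / 2))
       * (exp (q * c * s) / s powr ((real CARD('n) * (q - 1) + q) / 2)))"
    using pos unfolding m
    by (simp add: ln_mult ln_div ln_powr ln_realpow ln_sqrt l4) (simp add: field_simps)
  moreover have "(1 / (2 * s) * (exp (c * s) / ((2 * sqrt (pi * s)) ^ CARD('n) * D))) powr q
     * D * sqrt (pi / (q / (4 * s))) ^ (CARD('n) - 1) * (g / (q / (4 * s)) powr ((q + 1) / 2)) > 0"
    using pos by simp
  moreover have "D powr (1 - q) * 2 powr (real CARD('n) * (1 - q)) *
     pi powr ((real CARD('n) - 1 - real CARD('n) * q) / 2) * (g / q powr ((real CARD('n) + q) / 2))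
       * (exp (q * c * s) / s powr ((real CARD('n) * (q - 1) + q) / 2)) > 0"
    using pos by simp
  ultimately show ?thesis unfolding grad_const_def D_def[symmetric] g_def[symmetric]
    using ln_inj_iff by blast
qed

text \<open>In the variable w = R (z + s b) with R = A^-1/2, the integrand is |w . R l|^q times a
  Gaussian of parameter q/(4s). The change of variables contributes det A^1/2, and homogeneity of
  the moment releases |R l|^q.\<close>

lemma nn_integral_heat_grad_powr:
  assumes q: "q > 0" and s: "s > 0"
  shows "(\<integral>\<^sup>+z. ennreal (\<bar>heat_grad A b c z s \<bullet> l\<bar> powr q) \<partial>lborel)
    = ennreal (norm (inv_sqrt A *v l) powr q *
        (grad_const A q * (exp (q * c * s) / s powr ((real CARD('n) * (q - 1) + q) / 2))))"
proof -
  let ?D = "det (psd_sqrt A)" and ?v = "inv_sqrt A *v l"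
  let ?M = "1 / (2 * s) * (exp (c * s) / ((2 * sqrt (pi * s)) ^ CARD('n) * ?D))"
  let ?\<psi> = "\<lambda>r::real. ennreal (\<bar>r\<bar> powr q)"
  define F where "F w = ?\<psi> (w \<bullet> ?v) * ennreal (exp (- (q / (4 * s) * (norm w)\<^sup>2)))" for w :: "real^'n"
  have [measurable]: "F \<in> borel_measurable borel" unfolding F_def by measurable
  have D: "?D > 0" by (rule det_psd_sqrt_pos)
  have M: "?M > 0" using D s by simp
  have pw: "\<bar>heat_grad A b c z s \<bullet> l\<bar> powr q = ?M powr q *
     (\<bar>(inv_sqrt A *v (z + s *\<^sub>R b)) \<bullet> ?v\<bar> powr q * exp (- (q / (4 * s) * (norm (inv_sqrt A *v (z + s *\<^sub>R b)))\<^sup>2)))" for z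
  proof -
    let ?w = "inv_sqrt A *v (z + s *\<^sub>R b)"
    have "\<bar>heat_grad A b c z s \<bullet> l\<bar> = ?M * exp (- (1 / (4 * s) * (norm ?w)\<^sup>2)) * \<bar>?w \<bullet> ?v\<bar>"
      using D s by (simp add: inner_heat_grad heat_kernel_def abs_mult)
    then have "\<bar>heat_grad A b c z s \<bullet> l\<bar> powr q
       = ?M powr q * exp (- (1 / (4 * s) * (norm ?w)\<^sup>2)) powr q * \<bar>?w \<bullet> ?v\<bar> powr q"
      using M by (simp only: powr_mult)
    also have "exp (- (1 / (4 * s) * (norm ?w)\<^sup>2)) powr q = exp (- (q / (4 * s) * (norm ?w)\<^sup>2))"
      by (simp add: powr_def)
    finally show ?thesis by (simp only: ac_simps)
  qed
  have "(\<integral>\<^sup>+z. ennreal (\<bar>heat_grad A b c z s \<bullet> l\<bar> powr q) \<partial>lborel)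
     = ennreal (?M powr q) * (\<integral>\<^sup>+z. F (inv_sqrt A *v (z + s *\<^sub>R b)) \<partial>lborel)"
    unfolding pw F_def
    by (subst nn_integral_cmult[symmetric]) (auto simp only: ennreal_mult' powr_ge_zero, measurable)
  also have "(\<integral>\<^sup>+z. F (inv_sqrt A *v (z + s *\<^sub>R b)) \<partial>lborel) = ennreal ?D * (\<integral>\<^sup>+z. F z \<partial>lborel)"
    by (rule nn_integral_inv_sqrt) simp
  also have "(\<integral>\<^sup>+z. F z \<partial>lborel) = ennreal (sqrt (pi / (q / (4 * s))) ^ (CARD('n) - 1)) *
      (\<integral>\<^sup>+r. ?\<psi> (norm ?v * r) * ennreal (exp (- (q / (4 * s) * r\<^sup>2))) \<partial>lborel)"
    unfolding F_def using q s by (intro nn_integral_ridge_gaussian) auto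
  also have "(\<integral>\<^sup>+r. ?\<psi> (norm ?v * r) * ennreal (exp (- (q / (4 * s) * r\<^sup>2))) \<partial>lborel)
     = (\<integral>\<^sup>+r. ennreal (norm ?v powr q) * (?\<psi> r * ennreal (exp (- (q / (4 * s) * r\<^sup>2)))) \<partial>lborel)"
    by (simp add: abs_mult powr_mult ennreal_mult' mult.assoc)
  also have "\<dots> = ennreal (norm ?v powr q) * ennreal (Gamma ((q + 1) / 2) / (q / (4 * s)) powr ((q + 1) / 2))"
    using q s by (subst nn_integral_cmult) (use nn_integral_abs_moment_gaussian[of q "q / (4 * s)"] in auto)
  also have "ennreal (?M powr q) * (ennreal ?D * (ennreal (sqrt (pi / (q / (4 * s))) ^ (CARD('n) - 1)) *
       (ennreal (norm ?v powr q) * ennreal (Gamma ((q + 1) / 2) / (q / (4 * s)) powr ((q + 1) / 2)))))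
     = ennreal (norm ?v powr q * (?M powr q * ?D * sqrt (pi / (q / (4 * s))) ^ (CARD('n) - 1)
       * (Gamma ((q + 1) / 2) / (q / (4 * s)) powr ((q + 1) / 2))))"
  proof -
    have aux: "ennreal m * (ennreal d * (ennreal r * (ennreal k * ennreal g))) = ennreal (k * (m * d * r * g))"
      if "m \<ge> 0" "d \<ge> 0" "r \<ge> 0" "k \<ge> 0" "g \<ge> 0" for m d r k g
      using that by (simp add: ennreal_mult'[symmetric] ac_simps del: ennreal_mult'')
    show ?thesis
      by (rule aux) (use D q s Gamma_real_pos[of "(q + 1) / 2"] in auto)
  qed
  finally show ?thesis by (simp only: grad_const_scaling[OF q s])
qed

end

section \<open>The kernel on the strip\<close>

lemma set_integrable_exp_div_powr:
  fixes k \<beta> t :: real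
  assumes \<beta>: "\<beta> < 1"
  shows "set_integrable lborel {0<..<t} (\<lambda>\<tau>. exp (k * \<tau>) / \<tau> powr \<beta>)"
proof (cases "t > 0")
  case True
  have "((\<lambda>x. x powr (- \<beta>)) has_integral t powr (- \<beta> + 1) / (- \<beta> + 1)) {0..t}"
    using \<beta> True by (intro has_integral_powr_from_0) auto
  from nn_integral_has_integral_lebesgue'[OF _ this]
  have fin: "(\<integral>\<^sup>+x. ennreal (x powr (- \<beta>)) * indicator {0..t} x \<partial>lborel) < \<infinity>" by simp
  show ?thesis
    unfolding set_integrable_def
  proof (rule integrableI_bounded)
    have "(\<integral>\<^sup>+x. ennreal (norm (indicator {0<..<t} x *\<^sub>R (exp (k * x) / x powr \<beta>))) \<partial>lborel)
      \<le> (\<integral>\<^sup>+x. ennreal (exp (\<bar>k\<bar> * t)) * (ennreal (x powr (- \<beta>)) * indicator {0..t} x) \<partial>lborel)"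
    proof (rule nn_integral_mono)
      fix x :: real
      have "exp (k * x) / x powr \<beta> \<le> exp (\<bar>k\<bar> * t) * x powr (- \<beta>)" if "0 < x" "x < t"
      proof -
        have "k * x \<le> \<bar>k\<bar> * t" using that by (intro mult_mono) auto
        then show ?thesis by (simp add: powr_minus divide_inverse mult_right_mono)
      qed
      then show "ennreal (norm (indicator {0<..<t} x *\<^sub>R (exp (k * x) / x powr \<beta>)))
        \<le> ennreal (exp (\<bar>k\<bar> * t)) * (ennreal (x powr (- \<beta>)) * indicator {0..t} x)"
        by (auto simp: indicator_def ennreal_mult'[symmetric] intro!: ennreal_leI simp del: ennreal_mult'')
    qed
    also have "\<dots> = ennreal (exp (\<bar>k\<bar> * t)) * (\<integral>\<^sup>+x. ennreal (x powr (- \<beta>)) * indicator {0..t} x \<partial>lborel)"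
      by (rule nn_integral_cmult) auto
    also have "\<dots> < \<infinity>" using fin by (simp add: ennreal_mult_less_top)
    finally show "(\<integral>\<^sup>+x. ennreal (norm (indicator {0<..<t} x *\<^sub>R (exp (k * x) / x powr \<beta>))) \<partial>lborel) < \<infinity>" .
  qed measurable
qed (simp add: set_integrable_def)

lemma sets_strip [measurable]: "strip t \<in> sets borel"
  unfolding strip_def by (intro borel_open open_Times) auto

lemma nn_integral_strip:
  fixes F :: "(real^'n) \<times> real \<Rightarrow> ennreal"
  assumes [measurable]: "F \<in> borel_measurable borel"
  shows "(\<integral>\<^sup>+w. indicator (strip t) w * F w \<partial>lborel)
     = (\<integral>\<^sup>+s. indicator {0<..<t} s * (\<integral>\<^sup>+z. F (z, s) \<partial>lborel) \<partial>lborel)"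
proof -
  have F: "F \<in> borel_measurable (borel \<Otimes>\<^sub>M borel)" by (simp add: borel_prod)
  have "(\<integral>\<^sup>+w. indicator (strip t) w * F w \<partial>lborel)
      = (\<integral>\<^sup>+w. indicator (strip t) w * F w \<partial>(lborel \<Otimes>\<^sub>M lborel))"
    by (simp add: lborel_prod)
  also have "\<dots> = (\<integral>\<^sup>+s. \<integral>\<^sup>+z. indicator (strip t) (z, s) * F (z, s) \<partial>lborel \<partial>lborel)"
    by (rule lborel_pair.nn_integral_snd[symmetric]) (simp add: lborel_prod)
  also have "\<dots> = (\<integral>\<^sup>+s. \<integral>\<^sup>+z. indicator {0<..<t} s * F (z, s) \<partial>lborel \<partial>lborel)"
    by (simp add: strip_def indicator_def)
  also have "\<dots> = (\<integral>\<^sup>+s. indicator {0<..<t} s * (\<integral>\<^sup>+z. F (z, s) \<partial>lborel) \<partial>lborel)"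
    using F by (intro nn_integral_cong nn_integral_cmult) (auto intro!: measurable_compose[OF measurable_Pair2' F])
  finally show ?thesis .
qed

text \<open>Cutting the kernel to times in (0, t) turns u(., t) into a convolution over the whole of
  R^(n+1): at the argument (x, t) - z the indicator restricts the time of z to (0, t).\<close>

definition heat_kernel_strip :: "real^'n^'n \<Rightarrow> real^'n \<Rightarrow> real \<Rightarrow> real \<Rightarrow> (real^'n) \<times> real \<Rightarrow> real" where
  "heat_kernel_strip A b c t w = indicator (strip t) w * heat_kernel A b c (fst w) (snd w)"

definition heat_grad_strip :: "real^'n^'n \<Rightarrow> real^'n \<Rightarrow> real \<Rightarrow> real \<Rightarrow> (real^'n) \<times> real \<Rightarrow> real^'n" where
  "heat_grad_strip A b c t w = indicator (strip t) w *\<^sub>R heat_grad A b c (fst w) (snd w)"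

definition time_integral :: "real \<Rightarrow> real \<Rightarrow> real \<Rightarrow> real \<Rightarrow> real" where
  "time_integral n c q t = set_lebesgue_integral lborel {0<..<t} (\<lambda>\<tau>. exp (q * c * \<tau>) / \<tau> powr ((n * (q - 1) + q) / 2))"

lemma borel_measurable_heat_kernel_strip [measurable]: "heat_kernel_strip A b c t \<in> borel_measurable borel"
  unfolding heat_kernel_strip_def[abs_def] by measurable

lemma borel_measurable_heat_grad_strip [measurable]: "heat_grad_strip A b c t \<in> borel_measurable borel"
  unfolding heat_grad_strip_def[abs_def] by measurable

context
  fixes A :: "real^'n^'n" and b :: "real^'n" and c t :: real
  assumes A: "symmetric_mat A" "pos_def_mat A"
begin

lemma nn_integral_heat_grad_strip_powr:
  assumes q: "q > 0" "(real CARD('n) * (q - 1) + q) / 2 < 1"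
  shows "(\<integral>\<^sup>+w. ennreal (\<bar>heat_grad_strip A b c t w \<bullet> l\<bar> powr q) \<partial>lborel)
    = ennreal (norm (inv_sqrt A *v l) powr q * (grad_const A q * time_integral CARD('n) c q t))"
proof -
  let ?v = "norm (inv_sqrt A *v l) powr q"
  let ?e = "\<lambda>s. exp (q * c * s) / s powr ((real CARD('n) * (q - 1) + q) / 2)"
  have g: "grad_const A q > 0" by (rule grad_const_pos[OF A q(1)])
  have int: "set_integrable lborel {0<..<t} ?e"
    using set_integrable_exp_div_powr[OF q(2), of t "q * c"] by simp
  have "(\<integral>\<^sup>+w. ennreal (\<bar>heat_grad_strip A b c t w \<bullet> l\<bar> powr q) \<partial>lborel)
     = (\<integral>\<^sup>+w. indicator (strip t) w * ennreal (\<bar>heat_grad A b c (fst w) (snd w) \<bullet> l\<bar> powr q) \<partial>lborel)"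
    by (intro nn_integral_cong) (auto simp: heat_grad_strip_def indicator_def)
  also have "\<dots> = (\<integral>\<^sup>+s. indicator {0<..<t} s * (\<integral>\<^sup>+z. ennreal (\<bar>heat_grad A b c z s \<bullet> l\<bar> powr q) \<partial>lborel) \<partial>lborel)"
    by (subst nn_integral_strip) simp_all
  also have "\<dots> = (\<integral>\<^sup>+s. ennreal (?v * grad_const A q) * ennreal (indicator {0<..<t} s *\<^sub>R ?e s) \<partial>lborel)"
    using g by (intro nn_integral_cong)
      (auto simp: indicator_def nn_integral_heat_grad_powr[OF A q(1)] ennreal_mult'[symmetric] mult.assoc simp del: ennreal_mult'')
  also have "\<dots> = ennreal (?v * grad_const A q) * (\<integral>\<^sup>+s. ennreal (indicator {0<..<t} s *\<^sub>R ?e s) \<partial>lborel)"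
    by (rule nn_integral_cmult) simp
  also have "(\<integral>\<^sup>+s. ennreal (indicator {0<..<t} s *\<^sub>R ?e s) \<partial>lborel) = ennreal (time_integral CARD('n) c q t)"
    unfolding time_integral_def set_lebesgue_integral_def
    using int unfolding set_integrable_def by (intro nn_integral_eq_integral) auto
  also have "ennreal (?v * grad_const A q) * \<dots> = ennreal (?v * (grad_const A q * time_integral CARD('n) c q t))"
    using g by (simp add: ennreal_mult'[symmetric] mult.assoc del: ennreal_mult'')
  finally show ?thesis .
qed

lemma integrable_heat_kernel_strip: "integrable lborel (heat_kernel_strip A b c t)"
proof (rule integrableI_bounded)
  have "(\<integral>\<^sup>+w. ennreal (norm (heat_kernel_strip A b c t w)) \<partial>lborel)
     = (\<integral>\<^sup>+w. indicator (strip t) w * ennreal (heat_kernel A b c (fst w) (snd w)) \<partial>lborel)"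
    by (intro nn_integral_cong)
       (auto simp: heat_kernel_strip_def indicator_def abs_mult strip_def abs_of_nonneg heat_kernel_nonneg[OF A])
  also have "\<dots> = (\<integral>\<^sup>+s. indicator {0<..<t} s * (\<integral>\<^sup>+z. ennreal (heat_kernel A b c z s) \<partial>lborel) \<partial>lborel)"
    by (subst nn_integral_strip) simp_all
  also have "\<dots> \<le> (\<integral>\<^sup>+s. ennreal (exp (\<bar>c\<bar> * \<bar>t\<bar>)) * indicator {0<..<t} s \<partial>lborel)"
  proof (rule nn_integral_mono)
    fix s
    have "c * s \<le> \<bar>c\<bar> * \<bar>t\<bar>" if "0 < s" "s < t" using that by (intro mult_mono) auto
    then show "indicator {0<..<t} s * (\<integral>\<^sup>+z. ennreal (heat_kernel A b c z s) \<partial>lborel) \<le> ennreal (exp (\<bar>c\<bar> * \<bar>t\<bar>)) * indicator {0<..<t} s"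
      by (auto simp: indicator_def nn_integral_heat_kernel[OF A] intro!: ennreal_leI)
  qed
  also have "\<dots> < \<infinity>"
    by (cases "0 \<le> t") (simp_all add: nn_integral_cmult_indicator ennreal_mult_less_top)
  finally show "(\<integral>\<^sup>+w. ennreal (norm (heat_kernel_strip A b c t w)) \<partial>lborel) < \<infinity>" .
qed measurable

text \<open>The case q = 1 of the power integral, coordinate by coordinate; the time exponent is
  then 1/2.\<close>

lemma integrable_heat_grad_strip: "integrable lborel (heat_grad_strip A b c t)"
proof -
  have "integrable lborel (\<lambda>w. heat_grad_strip A b c t w \<bullet> l)" for l
    using nn_integral_heat_grad_strip_powr[of 1 l] by (intro integrableI_bounded) auto
  then have "integrable lborel (\<lambda>w. \<Sum>l\<in>Basis. (heat_grad_strip A b c t w \<bullet> l) *\<^sub>R l)"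
    by (intro Bochner_Integration.integrable_sum integrable_scaleR_left)
  then show ?thesis by (simp add: euclidean_representation)
qed

lemma heat_kernel_strip_has_derivative:
  "((\<lambda>x. heat_kernel_strip A b c t (x, s)) has_derivative (\<lambda>h. heat_grad_strip A b c t (x, s) \<bullet> h)) (at x)"
proof (cases "s \<in> {0<..<t}")
  case True
  then show ?thesis
    using heat_kernel_has_derivative[OF A] by (simp add: heat_kernel_strip_def heat_grad_strip_def strip_def)
qed (simp add: heat_kernel_strip_def heat_grad_strip_def strip_def)

lemma continuous_heat_grad_strip: "continuous_on UNIV (\<lambda>x. heat_grad_strip A b c t (x, s))"
  using continuous_heat_grad[of A b c s]
  by (cases "s \<in> {0<..<t}") (simp_all add: heat_grad_strip_def strip_def)

text \<open>\<open>heat_solution\<close> is an iterated integral, while differentiation is carried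
  out for an integral over space-time. Fubini's theorem identifies them, and g has to agree with f
  only where the cut kernel is nonzero.\<close>

lemma heat_solution_conv:
  assumes g: "continuous_on UNIV g" "\<And>z. \<bar>g z\<bar> \<le> B"
    and fg: "\<And>y \<tau>. 0 < \<tau> \<Longrightarrow> \<tau> < t \<Longrightarrow> f (y, \<tau>) = g (y, \<tau>)"
  shows "heat_solution A b c f x t = (\<integral>z. heat_kernel_strip A b c t ((x, t) - z) * g z \<partial>lborel)"
proof -
  have [measurable]: "g \<in> borel_measurable borel" using g(1) by (rule borel_measurable_continuous_onI)
  let ?H = "\<lambda>z. heat_kernel_strip A b c t ((x, t) - z) * g z"
  have "integrable lborel ?H"
    using integrable_mult_bounded[OF integrable_lborel_reflect[OF integrable_heat_kernel_strip, of "(x, t)"] _ g(2)]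
    by (simp add: mult.commute)
  then have "integrable (lborel \<Otimes>\<^sub>M lborel) (case_prod (\<lambda>y \<tau>. ?H (y, \<tau>)))"
    by (simp only: lborel_prod split_def prod.collapse)
  from lborel_pair.integral_snd[OF this]
  have "(\<integral>z. ?H z \<partial>lborel) = (\<integral>\<tau>. \<integral>y. ?H (y, \<tau>) \<partial>lborel \<partial>lborel)"
    by (simp only: lborel_prod split_def prod.collapse)
  also have "\<dots> = heat_solution A b c f x t"
    unfolding heat_solution_def set_lebesgue_integral_def
  proof (rule Bochner_Integration.integral_cong)
    fix \<tau>
    show "(\<integral>y. ?H (y, \<tau>) \<partial>lborel) = indicator {0<..<t} \<tau> *\<^sub>R (\<integral>y. heat_kernel A b c (x - y) (t - \<tau>) * f (y, \<tau>) \<partial>lborel)"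
      by (cases "\<tau> \<in> {0<..<t}") (auto simp: heat_kernel_strip_def strip_def indicator_def fg)
  qed simp
  finally show ?thesis by simp
qed

lemma heat_solution_gradient:
  assumes f: "holder_class \<alpha> T f" and t: "0 < t" "t < T"
  shows "((\<lambda>y. heat_solution A b c f y t) has_derivative
      (\<lambda>h. (\<integral>z. f z *\<^sub>R heat_grad_strip A b c t ((x, t) - z) \<partial>lborel) \<bullet> h)) (at x)"
    "integrable lborel (\<lambda>z. f z *\<^sub>R heat_grad_strip A b c t ((x, t) - z))"
proof -
  \<comment> \<open>Clamping the time to [0, T] extends f from the closed strip to a bounded
    continuous function on the whole space, without changing it at times in (0, t).\<close>
  define g where "g = (\<lambda>z. f (fst z, max 0 (min T (snd z))))"
  have cf: "continuous_on (UNIV \<times> {0..T}) f" and bf: "bounded (f ` (UNIV \<times> {0..T}))"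
    using f by (auto simp: holder_class_def)
  have cg: "continuous_on UNIV g" unfolding g_def
    by (rule continuous_on_compose2[OF cf]) (use t in \<open>auto intro!: continuous_intros\<close>)
  obtain B where "\<And>z. z \<in> UNIV \<times> {0..T} \<Longrightarrow> \<bar>f z\<bar> \<le> B" using bf by (auto simp: bounded_iff)
  then have B: "\<bar>g z\<bar> \<le> B" for z using t by (auto simp: g_def)
  have fg: "f z *\<^sub>R heat_grad_strip A b c t ((x, t) - z) = g z *\<^sub>R heat_grad_strip A b c t ((x, t) - z)" for z x
    using t by (cases z) (auto simp: g_def heat_grad_strip_def strip_def indicator_def)
  have eq: "heat_solution A b c f y t = (\<integral>z. heat_kernel_strip A b c t ((y, t) - z) * g z \<partial>lborel)" for y
    by (rule heat_solution_conv[OF cg B]) (use t in \<open>auto simp: g_def\<close>)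
  show "((\<lambda>y. heat_solution A b c f y t) has_derivative
      (\<lambda>h. (\<integral>z. f z *\<^sub>R heat_grad_strip A b c t ((x, t) - z) \<partial>lborel) \<bullet> h)) (at x)"
    unfolding eq fg
    by (rule convolution_has_derivative[OF integrable_heat_kernel_strip integrable_heat_grad_strip
          heat_kernel_strip_has_derivative continuous_heat_grad_strip cg B])
  have [measurable]: "g \<in> borel_measurable borel" using cg by (rule borel_measurable_continuous_onI)
  show "integrable lborel (\<lambda>z. f z *\<^sub>R heat_grad_strip A b c t ((x, t) - z))"
    unfolding fg
    by (rule integrable_mult_bounded[OF integrable_lborel_reflect[OF integrable_heat_grad_strip] _ B]) simp
qed

lemma grad_x_heat_solution:
  assumes f: "holder_class \<alpha> T f" and t: "0 < t" "t < T"
  shows "grad_x (heat_solution A b c f) x t = (\<integral>z. f z *\<^sub>R heat_grad_strip A b c t ((x, t) - z) \<partial>lborel)"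
proof -
  note frechet_derivative_at[OF heat_solution_gradient(1)[OF assms, of x], symmetric]
  then show ?thesis by (simp add: grad_x_def vec_eq_iff inner_axis)
qed

lemma dir_deriv_heat_solution:
  assumes f: "holder_class \<alpha> T f" and t: "0 < t" "t < T"
  shows "dir_deriv (heat_solution A b c f) l x t = (\<integral>z. (heat_grad_strip A b c t ((x, t) - z) \<bullet> l) * f z \<partial>lborel)"
    "integrable lborel (\<lambda>z. (heat_grad_strip A b c t ((x, t) - z) \<bullet> l) * f z)"
proof -
  note i = heat_solution_gradient(2)[OF assms, of x]
  show "dir_deriv (heat_solution A b c f) l x t = (\<integral>z. (heat_grad_strip A b c t ((x, t) - z) \<bullet> l) * f z \<partial>lborel)"
    unfolding dir_deriv_def grad_x_heat_solution[OF assms]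
    by (subst integral_inner_left[symmetric]) (use i in \<open>auto simp: mult.commute\<close>)
  show "integrable lborel (\<lambda>z. (heat_grad_strip A b c t ((x, t) - z) \<bullet> l) * f z)"
    using integrable_inner_left[of l, OF i] by (simp add: mult.commute)
qed

end

section \<open>Hoelder's inequality and Hoelder classes\<close>

text \<open>Young's inequality for |P|/a and |f|/b, with a and b the two norms, is integrated. A
  vanishing norm forbids this normalization, but then the product vanishes almost
  everywhere.\<close>

lemma Holder_inequality_integral:
  fixes P f :: "'a \<Rightarrow> real"
  assumes p: "p > 1" "q > 1" "1 / q + 1 / p = 1"
    and P: "integrable M (\<lambda>z. \<bar>P z\<bar> powr q)" "P \<in> borel_measurable M"
    and f: "integrable M (\<lambda>z. \<bar>f z\<bar> powr p)" "f \<in> borel_measurable M"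
  shows "\<bar>\<integral>z. P z * f z \<partial>M\<bar> \<le> (\<integral>z. \<bar>P z\<bar> powr q \<partial>M) powr (1 / q) * (\<integral>z. \<bar>f z\<bar> powr p \<partial>M) powr (1 / p)"
proof -
  define X where "X = (\<integral>z. \<bar>P z\<bar> powr q \<partial>M)"
  define Y where "Y = (\<integral>z. \<bar>f z\<bar> powr p \<partial>M)"
  have XY: "X \<ge> 0" "Y \<ge> 0" by (simp_all add: X_def Y_def)
  show ?thesis
  proof (cases "X = 0 \<or> Y = 0")
    case True
    have "AE z in M. P z * f z = 0"
    proof (cases "X = 0")
      case True
      then have "AE z in M. \<bar>P z\<bar> powr q = 0"
        using integral_nonneg_eq_0_iff_AE[OF P(1)] by (simp add: X_def)
      then show ?thesis by eventually_elim simp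
    next
      case False
      then have "Y = 0" using \<open>X = 0 \<or> Y = 0\<close> by simp
      then have "AE z in M. \<bar>f z\<bar> powr p = 0"
        using integral_nonneg_eq_0_iff_AE[OF f(1)] by (simp add: Y_def)
      then show ?thesis by eventually_elim simp
    qed
    then have "(\<integral>z. P z * f z \<partial>M) = 0"
      using P(2) f(2) by (subst integral_cong_AE[where g="\<lambda>_. 0"]) auto
    then show ?thesis by simp
  next
    case False
    then have pos: "X > 0" "Y > 0" using XY by auto
    define a b where "a = X powr (1 / q)" and "b = Y powr (1 / p)"
    have ab: "a > 0" "b > 0" using pos by (auto simp: a_def b_def)
    have aq: "a powr q = X" "b powr p = Y" using p pos by (auto simp: a_def b_def powr_powr)
    define w where "w z = a * b * ((\<bar>P z\<bar> powr q / X) / q + (\<bar>f z\<bar> powr p / Y) / p)" for z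
    have w: "integrable M w" unfolding w_def using P f by simp
    have le: "\<bar>P z * f z\<bar> \<le> w z" for z
    proof -
      have "(\<bar>P z\<bar> / a) * (\<bar>f z\<bar> / b) \<le> (\<bar>P z\<bar> / a) powr q / q + (\<bar>f z\<bar> / b) powr p / p"
        using p ab by (intro Youngs_inequality) auto
      also have "\<dots> = (\<bar>P z\<bar> powr q / X) / q + (\<bar>f z\<bar> powr p / Y) / p"
        using ab by (simp add: powr_divide aq)
      finally have "a * b * ((\<bar>P z\<bar> / a) * (\<bar>f z\<bar> / b)) \<le> w z"
        unfolding w_def using ab by (intro mult_left_mono) auto
      then show ?thesis using ab by (simp add: abs_mult)
    qed
    have "integrable M (\<lambda>z. P z * f z)"
      by (rule Bochner_Integration.integrable_bound[OF w]) (use P(2) f(2) le in \<open>auto intro!: AE_I2 order_trans[OF le]\<close>)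
    then have "(\<integral>z. \<bar>P z * f z\<bar> \<partial>M) \<le> (\<integral>z. w z \<partial>M)"
      using w le by (intro integral_mono integrable_abs)
    then have "\<bar>\<integral>z. P z * f z \<partial>M\<bar> \<le> (\<integral>z. w z \<partial>M)"
      using integral_abs_bound[of M "\<lambda>z. P z * f z"] by linarith
    also have "\<dots> = a * b * ((X / X) / q + (Y / Y) / p)"
      unfolding w_def X_def Y_def using P(1) f(1) by simp
    also have "\<dots> = a * b" using pos p(3) by simp
    finally show ?thesis by (simp add: a_def b_def X_def Y_def)
  qed
qed

text \<open>The gradient is bounded on compact parts of the closed strip, so f is Lipschitz in x
  there, uniformly in time; on a set of diameter at most d, |x - y| is at most d^(1-alpha) |x -
  y|^alpha. The convex hull of K supplies the segments for the mean value inequality.\<close>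

lemma holder_class_C1:
  fixes f :: "(real^'n) \<times> real \<Rightarrow> real" and D :: "(real^'n) \<times> real \<Rightarrow> real^'n"
  assumes cont: "continuous_on UNIV f" and bd: "\<And>z. \<bar>f z\<bar> \<le> B"
    and der: "\<And>y \<tau>. ((\<lambda>y. f (y, \<tau>)) has_derivative (\<lambda>h. D (y, \<tau>) \<bullet> h)) (at y)"
    and contD: "continuous_on UNIV D" and \<alpha>: "0 < \<alpha>" "\<alpha> < 1"
  shows "holder_class \<alpha> T f"
  unfolding holder_class_def
proof (intro conjI allI impI)
  show "continuous_on (UNIV \<times> {0..T}) f" using cont by (rule continuous_on_subset) simp
  show "bounded (f ` (UNIV \<times> {0..T}))" using bd by (auto simp: bounded_iff)
  fix K :: "(real^'n) set" assume K: "compact K"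
  define K' where "K' = convex hull K"
  have "compact (K' \<times> {0..T})" unfolding K'_def by (intro compact_Times compact_convex_hull K compact_Icc)
  then have "bounded (D ` (K' \<times> {0..T}))"
    by (intro compact_imp_bounded compact_continuous_image continuous_on_subset[OF contD]) auto
  then obtain C where C: "\<And>z. z \<in> K' \<times> {0..T} \<Longrightarrow> norm (D z) \<le> C"
    by (auto simp: bounded_iff)
  obtain d where d: "\<And>x y. x \<in> K \<Longrightarrow> y \<in> K \<Longrightarrow> dist x y \<le> d"
    using compact_imp_bounded[OF K] by (metis bounded_two_points)
  have "\<bar>f (x, t) - f (y, t)\<bar> \<le> (\<bar>C\<bar> * d powr (1 - \<alpha>)) * dist x y powr \<alpha>"
    if t: "t \<in> {0..T}" and xy: "x \<in> K" "y \<in> K" for t x y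
  proof -
    have "norm (f (x, t) - f (y, t)) \<le> \<bar>C\<bar> * norm (x - y)"
    proof (rule differentiable_bound[where S=K' and f'="\<lambda>y h. D (y, t) \<bullet> h"])
      show "convex K'" "x \<in> K'" "y \<in> K'" using xy by (auto simp: K'_def hull_inc)
      fix u assume u: "u \<in> K'"
      show "((\<lambda>x. f (x, t)) has_derivative (\<lambda>h. D (u, t) \<bullet> h)) (at u within K')"
        using der by (rule has_derivative_at_withinI)
      show "onorm (\<lambda>h. D (u, t) \<bullet> h) \<le> \<bar>C\<bar>"
      proof (rule onorm_le)
        fix h
        have "\<bar>D (u, t) \<bullet> h\<bar> \<le> norm (D (u, t)) * norm h" by (rule Cauchy_Schwarz_ineq2)
        also have "\<dots> \<le> \<bar>C\<bar> * norm h" using C[of "(u, t)"] u t by (intro mult_right_mono) auto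
        finally show "norm (D (u, t) \<bullet> h) \<le> \<bar>C\<bar> * norm h" by simp
      qed
    qed
    also have "norm (x - y) = dist x y powr (1 - \<alpha>) * dist x y powr \<alpha>"
      by (cases "x = y") (simp_all add: powr_add[symmetric] dist_norm)
    also have "\<bar>C\<bar> * \<dots> \<le> \<bar>C\<bar> * (d powr (1 - \<alpha>) * dist x y powr \<alpha>)"
      using \<alpha> xy by (intro mult_left_mono mult_right_mono powr_mono2 d) auto
    finally show ?thesis by (simp add: mult.assoc)
  qed
  then show "\<exists>M. \<forall>t\<in>{0..T}. \<forall>x\<in>K. \<forall>y\<in>K. \<bar>f (x, t) - f (y, t)\<bar> \<le> M * dist x y powr \<alpha>" by blast
qed

section \<open>Regularity of the kernel at positive times and a smooth substitute for the power
  function\<close>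

lemma continuous_on_heat_kernel [continuous_intros]:
  assumes [continuous_intros]: "continuous_on S X" "continuous_on S s" and s: "\<And>z. z \<in> S \<Longrightarrow> s z > 0"
    and D: "det (psd_sqrt A) > 0"
  shows "continuous_on S (\<lambda>z. heat_kernel A b c (X z) (s z))"
  unfolding heat_kernel_def using s D by (intro continuous_intros) force+

lemma continuous_on_heat_grad [continuous_intros]:
  assumes [continuous_intros]: "continuous_on S X" "continuous_on S s" and s: "\<And>z. z \<in> S \<Longrightarrow> s z > 0"
    and D: "det (psd_sqrt A) > 0"
  shows "continuous_on S (\<lambda>z. heat_grad A b c (X z) (s z))"
  unfolding heat_grad_def using s D by (intro continuous_intros) force+

text \<open>Minus the Hessian of the kernel applied to l. The sign absorbs the reflection y to x - y
  under which the kernel enters the extremal functions.\<close>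

definition heat_hess :: "real^'n^'n \<Rightarrow> real^'n \<Rightarrow> real \<Rightarrow> real^'n \<Rightarrow> real^'n \<Rightarrow> real \<Rightarrow> real^'n" where
  "heat_hess A b c l x t = (1 / (2 * t)) *\<^sub>R
     (((inv_sqrt A *v (x + t *\<^sub>R b)) \<bullet> (inv_sqrt A *v l)) *\<^sub>R heat_grad A b c x t
       + heat_kernel A b c x t *\<^sub>R (inv_sqrt A *v (inv_sqrt A *v l)))"

lemma heat_grad_inner_has_derivative:
  assumes A: "symmetric_mat A" "pos_def_mat A"
  shows "((\<lambda>y. heat_grad A b c (x - y) s \<bullet> l) has_derivative (\<lambda>h. heat_hess A b c l (x - y) s \<bullet> h)) (at y)"
proof -
  let ?R = "inv_sqrt A"
  have k: "((\<lambda>y. heat_kernel A b c (x - y) s) has_derivative (\<lambda>h. heat_grad A b c (x - y) s \<bullet> (- h))) (at y)"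
    by (rule has_derivative_compose[OF _ heat_kernel_has_derivative[OF A]]) (auto intro!: derivative_eq_intros)
  have r: "((\<lambda>y. ?R *v (x - y + s *\<^sub>R b)) has_derivative (\<lambda>h. ?R *v (- h))) (at y)"
    by (rule has_derivative_compose[where g="\<lambda>y. ?R *v y"])
       (auto intro!: derivative_eq_intros bounded_linear.has_derivative[where f="\<lambda>y. ?R *v y"] matrix_vector_mul_bounded_linear)
  have "(?R *v h) \<bullet> (?R *v l) = (?R *v (?R *v l)) \<bullet> h" for h
    using symmetric_mat_inner[OF inv_sqrt(1)[OF A], of h "?R *v l"] by (simp add: inner_commute)
  then have R: "(?R *v (- h)) \<bullet> (?R *v l) = - ((?R *v (?R *v l)) \<bullet> h)" for h
    using linear_neg[OF matrix_vector_mul_linear[of ?R]] by simp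
  show ?thesis
    unfolding inner_heat_grad[OF A]
    by (rule has_derivative_eq_rhs, (rule derivative_intros k r)+, rule ext)
       (simp add: R heat_hess_def inner_add_left algebra_simps)
qed

text \<open>A substitute of class C^1 for sgn(s) |s|^(2e+1), used with 2e + 1 = q - 1. The d inside
  the power removes the singularity at s = 0 and the denominator makes the function bounded; for e
  \<le> 0 both only decrease the absolute value.\<close>

definition damped_power :: "real \<Rightarrow> real \<Rightarrow> real \<Rightarrow> real" where
  "damped_power e d s = s * (s\<^sup>2 + d) powr e / (1 + d * s\<^sup>2)"

lemma damped_power_C1:
  assumes d: "d > 0"
  obtains D where "\<And>s. (damped_power e d has_real_derivative D s) (at s)" "continuous_on UNIV D"
proof
  let ?D = "\<lambda>s. (((s\<^sup>2 + d) powr e + s * (e * (s\<^sup>2 + d) powr (e - 1) * (2 * s))) * (1 + d * s\<^sup>2)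
     - s * (s\<^sup>2 + d) powr e * (d * (2 * s))) / ((1 + d * s\<^sup>2) * (1 + d * s\<^sup>2))"
  have pos: "s\<^sup>2 + d > 0" "1 + d * s\<^sup>2 > 0" for s using d by (auto intro: add_nonneg_pos add_pos_nonneg)
  show "(damped_power e d has_real_derivative ?D s) (at s)" for s
  proof -
    have sq: "((\<lambda>s. s\<^sup>2 + d) has_real_derivative 2 * s) (at s)"
      by (auto intro!: derivative_eq_intros)
    have pw: "((\<lambda>s. (s\<^sup>2 + d) powr e) has_real_derivative e * (s\<^sup>2 + d) powr (e - 1) * (2 * s)) (at s)"
      using DERIV_fun_powr[OF sq pos(1), of e] by simp
    show ?thesis
      unfolding damped_power_def[abs_def]
      by (rule DERIV_cong, (rule derivative_intros pw)+) (use pos(2)[of s] in \<open>auto simp: algebra_simps\<close>)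
  qed
  show "continuous_on UNIV ?D"
    using pos by (intro continuous_intros) (auto simp: less_imp_neq[symmetric])
qed

text \<open>Since e \<le> 0, dropping d from s^2 + d increases the power. The bound does not involve
  d, so it serves for dominated convergence as well as for the norms of the extremal
  functions.\<close>

lemma abs_damped_power_le:
  assumes "d > 0" "e \<le> 0"
  shows "\<bar>damped_power e d s\<bar> \<le> \<bar>s\<bar> powr (2 * e + 1)"
proof (cases "s = 0")
  case False
  have "1 \<le> 1 + d * s\<^sup>2" using assms by simp
  then have "\<bar>damped_power e d s\<bar> \<le> \<bar>s\<bar> * (s\<^sup>2 + d) powr e"
    unfolding damped_power_def using mult_left_mono[of 1 "1 + d * s\<^sup>2" "\<bar>s\<bar> * (s\<^sup>2 + d) powr e"]
    by (simp add: abs_mult divide_le_eq)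
  also have "\<dots> \<le> \<bar>s\<bar> * (s\<^sup>2) powr e"
    using assms False by (intro mult_left_mono powr_mono2') auto
  also have "(s\<^sup>2) powr e = \<bar>s\<bar> powr (2 * e)"
    using powr_powr[of "\<bar>s\<bar>" 2 e] False by simp
  also have "\<bar>s\<bar> * \<bar>s\<bar> powr (2 * e) = \<bar>s\<bar> powr (2 * e + 1)"
    using False by (simp add: powr_add)
  finally show ?thesis .
qed (simp add: damped_power_def)

lemma bounded_damped_power:
  assumes "d > 0" "d \<le> 1" "e \<le> 0"
  shows "\<bar>damped_power e d s\<bar> \<le> d powr e / d"
proof -
  have "\<bar>s\<bar> \<le> 1 + s\<^sup>2" using zero_le_power2[of "\<bar>s\<bar> - 1"] zero_le_power2[of s] by (simp add: power2_diff)
  moreover have "d * (1 + s\<^sup>2) \<le> 1 + d * s\<^sup>2" using assms by (simp add: algebra_simps)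
  ultimately have "d * \<bar>s\<bar> \<le> 1 + d * s\<^sup>2" using assms by (meson less_imp_le mult_left_mono order_trans)
  then have 1: "\<bar>s\<bar> / (1 + d * s\<^sup>2) \<le> 1 / d" using assms by (simp add: field_simps add_pos_nonneg)
  have 2: "(s\<^sup>2 + d) powr e \<le> d powr e" using assms by (intro powr_mono2') auto
  have "\<bar>damped_power e d s\<bar> = (s\<^sup>2 + d) powr e * (\<bar>s\<bar> / (1 + d * s\<^sup>2))"
    using assms by (simp add: damped_power_def abs_mult)
  also have "\<dots> \<le> d powr e * (1 / d)" using assms by (intro mult_mono 1 2) auto
  finally show ?thesis by simp
qed

lemma tendsto_mult_damped_power:
  assumes "(d \<longlongrightarrow> 0) F"
  shows "((\<lambda>m. s * damped_power e (d m) s) \<longlongrightarrow> \<bar>s\<bar> powr (2 * e + 2)) F"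
proof (cases "s = 0")
  case False
  have "((\<lambda>m. s * damped_power e (d m) s) \<longlongrightarrow> s * (s * (s\<^sup>2 + 0) powr e / (1 + 0 * s\<^sup>2))) F"
    unfolding damped_power_def using False assms by (intro tendsto_intros) auto
  moreover have "\<bar>s\<bar> powr (2 * e + 2) = s\<^sup>2 * (s\<^sup>2) powr e"
    using powr_powr[of "\<bar>s\<bar>" 2 e] False by (simp add: powr_add)
  ultimately show ?thesis by (simp add: power2_eq_square mult.assoc)
qed (simp add: damped_power_def)

section \<open>Extremal functions\<close>

text \<open>At a fixed distance r > 0 from the final time, both time cutoffs of
  \<open>extremal\<close> are inactive as soon as d < r/2.\<close>

lemma tendsto_max_min_eventually_const:
  fixes u d :: "nat \<Rightarrow> real"
  assumes d: "d \<longlonglongrightarrow> 0" "\<And>m. d m > 0" and r: "r > 0"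
  shows "\<forall>\<^sub>F m in sequentially. max (d m) r = r \<and> max 0 (min 1 (r / d m - 1)) = 1"
proof -
  have "\<forall>\<^sub>F m in sequentially. d m < r / 2" using order_tendstoD(2)[OF d(1), of "r / 2"] r by simp
  then show ?thesis
  proof eventually_elim
    case (elim m)
    have "2 \<le> r / d m" using elim d(2)[of m] by (simp add: le_divide_eq)
    then show ?case using elim r by (auto simp: max_def min_def)
  qed
qed

text \<open>The ramp in time is 0 within d of the final time t and 1 beyond 2d, which keeps the
  function away from the singularity. The maximum with d makes the kernel's time positive everywhere
  and changes nothing where the ramp is nonzero. With e = (q - 2)/2, \<open>damped_power\<close>
  imitates sgn P |P|^(q-1).\<close>

definition extremal :: "real^'n^'n \<Rightarrow> real^'n \<Rightarrow> real \<Rightarrow> real^'n \<Rightarrow> real^'n \<Rightarrow> real \<Rightarrow> real \<Rightarrow> real \<Rightarrow> (real^'n) \<times> real \<Rightarrow> real" where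
  "extremal A b c l x t q d z = max 0 (min 1 ((t - snd z) / d - 1)) *
     damped_power ((q - 2) / 2) d (heat_grad A b c (x - fst z) (max d (t - snd z)) \<bullet> l)"

context
  fixes A :: "real^'n^'n" and b :: "real^'n" and c :: real and l x :: "real^'n" and t q :: real
  assumes A: "symmetric_mat A" "pos_def_mat A" and q: "1 \<le> q" "q < 2"
begin

lemma continuous_extremal:
  assumes d: "d > 0"
  shows "continuous_on UNIV (extremal A b c l x t q d)"
proof -
  obtain D where "\<And>s. (damped_power ((q - 2) / 2) d has_real_derivative D s) (at s)"
    using damped_power_C1[OF d] by blast
  then have "continuous_on UNIV (damped_power ((q - 2) / 2) d)"
    by (intro continuous_at_imp_continuous_on ballI DERIV_isCont)
  then show ?thesis
    unfolding extremal_def[abs_def] using d det_psd_sqrt_pos[OF A]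
    by (intro continuous_intros continuous_on_compose2[where f="\<lambda>z. heat_grad A b c (x - fst z) (max d (t - snd z)) \<bullet> l"
          and g="damped_power ((q - 2) / 2) d"]) auto
qed

text \<open>The ramp has corners, but it depends on time alone; differentiability is required only
  in x, where the chain rule applies to \<open>damped_power\<close>.\<close>

lemma holder_class_extremal:
  assumes d: "0 < d" "d \<le> 1" and \<alpha>: "0 < \<alpha>" "\<alpha> < 1"
  shows "holder_class \<alpha> T (extremal A b c l x t q d)"
proof -
  let ?e = "(q - 2) / 2"
  obtain D where D: "\<And>s. (damped_power ?e d has_real_derivative D s) (at s)" "continuous_on UNIV D"
    using damped_power_C1[OF d(1)] by blast
  let ?\<chi> = "\<lambda>\<tau>. max 0 (min 1 ((t - \<tau>) / d - 1))"
  let ?k = "\<lambda>z. heat_grad A b c (x - fst z) (max d (t - snd z)) \<bullet> l"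
  let ?g = "\<lambda>z. (?\<chi> (snd z) * D (?k z)) *\<^sub>R heat_hess A b c l (x - fst z) (max d (t - snd z))"
  show ?thesis
  proof (rule holder_class_C1[where D = ?g])
    show "continuous_on UNIV (extremal A b c l x t q d)" by (rule continuous_extremal[OF d(1)])
    show "\<bar>extremal A b c l x t q d z\<bar> \<le> 1 * (d powr ?e / d)" for z
      unfolding extremal_def abs_mult
      using q d by (intro mult_mono bounded_damped_power) auto
    show "((\<lambda>y. extremal A b c l x t q d (y, \<tau>)) has_derivative (\<lambda>h. ?g (y, \<tau>) \<bullet> h)) (at y)" for y \<tau>
    proof -
      have "((\<lambda>y. damped_power ?e d (heat_grad A b c (x - y) (max d (t - \<tau>)) \<bullet> l)) has_derivative
          (\<lambda>h. D (?k (y, \<tau>)) * (heat_hess A b c l (x - y) (max d (t - \<tau>)) \<bullet> h))) (at y)"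
        using has_derivative_compose[OF heat_grad_inner_has_derivative[OF A, of b c x "max d (t - \<tau>)" l y]
            D(1)[unfolded has_field_derivative_def]] by simp
      then have "((\<lambda>y. ?\<chi> \<tau> * damped_power ?e d (heat_grad A b c (x - y) (max d (t - \<tau>)) \<bullet> l)) has_derivative
          (\<lambda>h. ?\<chi> \<tau> * (D (?k (y, \<tau>)) * (heat_hess A b c l (x - y) (max d (t - \<tau>)) \<bullet> h)))) (at y)"
        by (rule has_derivative_mult_right)
      then show ?thesis by (simp add: extremal_def mult.assoc)
    qed
    show "continuous_on UNIV ?g"
      unfolding heat_hess_def using d det_psd_sqrt_pos[OF A]
      by (intro continuous_intros continuous_on_compose2[OF D(2), where f="?k"]) (auto simp: max_def)
  qed (fact \<alpha>)+
qed

text \<open>Near the final time the ramp makes the left side zero; elsewhere \<open>max\<close> is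
  inactive and the bound for \<open>damped_power\<close> applies. For q = 1 the right side is
  \<open>0 powr 0\<close>, hence 0, at the zeros of P, where the left side vanishes too.\<close>

lemma abs_extremal_le:
  assumes d: "d > 0" and z: "z \<in> strip t"
  shows "\<bar>extremal A b c l x t q d z\<bar> \<le> \<bar>heat_grad_strip A b c t ((x, t) - z) \<bullet> l\<bar> powr (q - 1)"
proof (cases "t - snd z \<le> d")
  case True
  then have "(t - snd z) / d - 1 \<le> 0" using d by (simp add: divide_le_eq)
  then show ?thesis by (simp add: extremal_def)
next
  case False
  let ?k = "heat_grad A b c (x - fst z) (t - snd z) \<bullet> l"
  have "heat_grad_strip A b c t ((x, t) - z) \<bullet> l = ?k"
    using z by (cases z) (auto simp: heat_grad_strip_def strip_def)
  moreover have "max d (t - snd z) = t - snd z" using False by simp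
  moreover have "\<bar>max 0 (min 1 ((t - snd z) / d - 1)) * damped_power ((q - 2) / 2) d ?k\<bar>
      \<le> 1 * \<bar>?k\<bar> powr (2 * ((q - 2) / 2) + 1)"
    unfolding abs_mult using d q by (intro mult_mono abs_damped_power_le) auto
  ultimately show ?thesis by (simp add: extremal_def diff_divide_distrib)
qed

lemma extremal_eq_0: "d > 0 \<Longrightarrow> t \<le> snd z \<Longrightarrow> extremal A b c l x t q d z = 0"
  by (simp add: extremal_def max_def divide_le_eq)

text \<open>The dominating function is |P| |P|^(q-1) = |P|^q itself. At each point of the strip the
  time cutoffs are eventually inactive, so only the smoothing parameter is left in the
  limit.\<close>

lemma extremal_pairing_tendsto:
  assumes P: "integrable lborel (\<lambda>z. \<bar>heat_grad_strip A b c t ((x, t) - z) \<bullet> l\<bar> powr q)"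
  shows "(\<lambda>m. \<integral>z. (heat_grad_strip A b c t ((x, t) - z) \<bullet> l) * extremal A b c l x t q (inverse (real (Suc m))) z \<partial>lborel)
    \<longlonglongrightarrow> (\<integral>z. \<bar>heat_grad_strip A b c t ((x, t) - z) \<bullet> l\<bar> powr q \<partial>lborel)"
proof (rule integral_dominated_convergence[OF _ _ P])
  let ?P = "\<lambda>z. heat_grad_strip A b c t ((x, t) - z) \<bullet> l"
  let ?d = "\<lambda>m. inverse (real (Suc m))"
  have off: "?P z = 0" if "z \<notin> strip t" for z
    using that by (cases z) (auto simp: heat_grad_strip_def strip_def indicator_def)
  have [measurable]: "extremal A b c l x t q (?d m) \<in> borel_measurable borel" for m
    by (rule borel_measurable_continuous_onI[OF continuous_extremal]) simp
  show "(\<lambda>z. ?P z * extremal A b c l x t q (?d m) z) \<in> borel_measurable lborel" for m by measurable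
  show "(\<lambda>z. \<bar>?P z\<bar> powr q) \<in> borel_measurable lborel" by measurable
  show "AE z in lborel. norm (?P z * extremal A b c l x t q (?d m) z) \<le> \<bar>?P z\<bar> powr q" for m
  proof (rule AE_I2)
    fix z
    show "norm (?P z * extremal A b c l x t q (?d m) z) \<le> \<bar>?P z\<bar> powr q"
    proof (cases "z \<in> strip t \<and> ?P z \<noteq> 0")
      case True
      have "norm (?P z * extremal A b c l x t q (?d m) z) \<le> \<bar>?P z\<bar> * \<bar>?P z\<bar> powr (q - 1)"
        unfolding real_norm_def abs_mult using True by (intro mult_left_mono abs_extremal_le) auto
      also have "\<dots> = \<bar>?P z\<bar> powr q" using True powr_add[of "\<bar>?P z\<bar>" 1 "q - 1"] by simp
      finally show ?thesis .
    next
      case False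
      then have "?P z = 0" using off by blast
      then show ?thesis by simp
    qed
  qed
  show "AE z in lborel. (\<lambda>m. ?P z * extremal A b c l x t q (?d m) z) \<longlonglongrightarrow> \<bar>?P z\<bar> powr q"
  proof (rule AE_I2)
    fix z
    show "(\<lambda>m. ?P z * extremal A b c l x t q (?d m) z) \<longlonglongrightarrow> \<bar>?P z\<bar> powr q"
    proof (cases "z \<in> strip t")
      case True
      have Pz: "?P z = heat_grad A b c (x - fst z) (t - snd z) \<bullet> l"
        using True by (cases z) (auto simp: heat_grad_strip_def strip_def)
      have inverse_Suc: "?d m > 0" for m by simp
      have r: "t - snd z > 0" using True by (auto simp: strip_def)
      have "\<forall>\<^sub>F m in sequentially. ?P z * extremal A b c l x t q (?d m) z = ?P z * damped_power ((q - 2) / 2) (?d m) (?P z)"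
        using tendsto_max_min_eventually_const[OF LIMSEQ_inverse_real_of_nat inverse_Suc r]
        by eventually_elim (simp_all add: extremal_def Pz)
      from tendsto_cong[OF this]
      have "(\<lambda>m. ?P z * extremal A b c l x t q (?d m) z) \<longlonglongrightarrow> L
        \<longleftrightarrow> (\<lambda>m. ?P z * damped_power ((q - 2) / 2) (?d m) (?P z)) \<longlonglongrightarrow> L" for L .
      moreover have "(\<lambda>m. ?P z * damped_power ((q - 2) / 2) (?d m) (?P z)) \<longlonglongrightarrow> \<bar>?P z\<bar> powr (2 * ((q - 2) / 2) + 2)"
        by (rule tendsto_mult_damped_power[OF LIMSEQ_inverse_real_of_nat])
      moreover have "2 * ((q - 2) / 2) + 2 = q" by (simp add: field_simps)
      ultimately show ?thesis by (simp only:)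
    qed (simp add: off)
  qed
qed

end

section \<open>Closed forms of the constants\<close>

lemma time_integral_pos:
  assumes t: "t > 0" and q: "n \<ge> 0" "q \<ge> 1" "(n * (q - 1) + q) / 2 < 1"
  shows "time_integral n c q t > 0"
proof -
  let ?\<beta> = "(n * (q - 1) + q) / 2"
  have \<beta>: "?\<beta> \<ge> 0" using q by simp
  \<comment> \<open>A positive lower bound of the integrand on (0, t): the exponent is nonnegative,
    so the denominator is largest at t.\<close>
  define m where "m = exp (- (\<bar>q * c\<bar> * t)) / t powr ?\<beta>"
  have m: "m > 0" using t by (simp add: m_def)
  have int: "set_integrable lborel {0<..<t} (\<lambda>\<tau>. exp (q * c * \<tau>) / \<tau> powr ?\<beta>)"
    using set_integrable_exp_div_powr[OF q(3), of t "q * c"] by simp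
  have "m \<le> exp (q * c * \<tau>) / \<tau> powr ?\<beta>" if "0 < \<tau>" "\<tau> < t" for \<tau>
  proof -
    have "\<bar>q * c * \<tau>\<bar> \<le> \<bar>q * c\<bar> * t" using that unfolding abs_mult[of "q * c"] by (intro mult_left_mono) auto
    then have "- (\<bar>q * c\<bar> * t) \<le> q * c * \<tau>" by (simp only: abs_le_iff) linarith
    then show ?thesis unfolding m_def using that \<beta> by (intro frac_le powr_mono2) auto
  qed
  then have "indicator {0<..<t} \<tau> * m \<le> indicator {0<..<t} \<tau> *\<^sub>R (exp (q * c * \<tau>) / \<tau> powr ?\<beta>)" for \<tau>
    by (simp add: indicator_def)
  moreover have "integrable lborel (\<lambda>\<tau>. indicator {0<..<t} \<tau> * m)"
    using t by (intro integrable_mult_left integrable_real_indicator) auto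
  ultimately have "(\<integral>\<tau>. indicator {0<..<t} \<tau> * m \<partial>lborel) \<le> time_integral n c q t"
    unfolding time_integral_def set_lebesgue_integral_def using int unfolding set_integrable_def
    by (intro integral_mono)
  moreover have "(\<integral>\<tau>. indicator {0<..<t} \<tau> * m \<partial>lborel) = t * m" using t by simp
  ultimately show ?thesis using t m by (smt (verit) mult_pos_pos)
qed

text \<open>Only the prefactor needs work. Its exponents agree because (1 - q)/q = -1/p and (n - 1 -
  nq)/(2q) = -(n + p - 1)/(2p), again compared through logarithms.\<close>

lemma sharp_const_eq:
  fixes A :: "real^'n^'n"
  assumes A: "symmetric_mat A" "pos_def_mat A" and p: "real CARD('n) + 2 < p" and v: "v \<ge> 0"
    and q: "q = p / (p - 1)"
  shows "sharp_const A c p t v = (v powr q * (grad_const A q * time_integral CARD('n) c q t)) powr (1 / q)"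
proof -
  define D where "D = det (psd_sqrt A)"
  have D: "D > 0" unfolding D_def by (rule det_psd_sqrt_pos[OF A])
  have p2: "p > 2" using p by (smt (verit) of_nat_0_le_iff)
  have q0: "q > 1" using p2 by (simp add: q field_simps)
  define g where "g = Gamma ((q + 1) / 2) / q powr ((real CARD('n) + q) / 2)"
  have g: "g > 0" using q0 by (simp add: g_def Gamma_real_pos)
  define J where "J = time_integral CARD('n) c q t"
  have J: "J \<ge> 0" unfolding J_def time_integral_def set_lebesgue_integral_def
    by (intro integral_nonneg_AE) auto
  define K where "K = D powr (1 - q) * 2 powr (real CARD('n) * (1 - q)) * pi powr ((real CARD('n) - 1 - real CARD('n) * q) / 2)"
  have K: "K > 0" using D by (simp add: K_def)
  have gK: "grad_const A q = K * g" by (simp add: grad_const_def K_def g_def D_def)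
  have "K powr (1 / q) = 1 / (2 ^ CARD('n) * pi powr ((real CARD('n) + p - 1) / 2) * D) powr (1 / p)"
  proof -
    have e1: "1 / q * (1 - q) = - (1 / p)" using p2 by (simp add: q field_simps)
    define r M where "r = 1 / p" and "M = (real CARD('n) + p - 1) / 2"
    have e2: "1 / q * ((real CARD('n) - 1 - real CARD('n) * q) / 2) = - (r * M)"
      using p2 by (simp add: r_def M_def q field_simps)
    have "ln (K powr (1 / q)) = 1 / q * ((1 - q) * ln D + real CARD('n) * (1 - q) * ln 2
        + (real CARD('n) - 1 - real CARD('n) * q) / 2 * ln pi)"
      unfolding K_def using D by (simp add: ln_mult ln_powr)
    also have "\<dots> = (1 / q * (1 - q)) * (ln D + real CARD('n) * ln 2)
        + (1 / q * ((real CARD('n) - 1 - real CARD('n) * q) / 2)) * ln pi"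
      by (simp only: distrib_left mult_ac)
    also have "\<dots> = - (r * (real CARD('n) * ln 2 + M * ln pi + ln D))"
      unfolding e1 e2 r_def[symmetric] by (simp add: algebra_simps)
    also have "\<dots> = ln (1 / (2 ^ CARD('n) * pi powr ((real CARD('n) + p - 1) / 2) * D) powr (1 / p))"
      unfolding r_def M_def using D by (simp add: ln_mult ln_div ln_powr ln_realpow)
    finally have "ln (K powr (1 / q)) = ln (1 / (2 ^ CARD('n) * pi powr ((real CARD('n) + p - 1) / 2) * D) powr (1 / p))" .
    moreover have "K powr (1 / q) > 0" "1 / (2 ^ CARD('n) * pi powr ((real CARD('n) + p - 1) / 2) * D) powr (1 / p) > 0"
      using D K by simp_all
    ultimately show ?thesis using ln_inj_iff by blast
  qed
  moreover have "(v powr q * (grad_const A q * J)) powr (1 / q) = v * (K powr (1 / q) * (g * J) powr (1 / q))"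
    using q0 v K g J by (simp add: gK powr_mult powr_powr mult.assoc)
  ultimately show ?thesis
    by (simp add: sharp_const_def Let_def q[symmetric] D_def g_def J_def time_integral_def)
qed

text \<open>The limiting case q = 1: the powers of 2 and of the determinant become 1, Gamma(1) = 1,
  and the power of pi is pi^(-1/2).\<close>

lemma sharp_const_inf_eq:
  fixes A :: "real^'n^'n"
  assumes A: "symmetric_mat A" "pos_def_mat A" and v: "v \<ge> 0"
  shows "sharp_const_inf c t v = v powr 1 * (grad_const A 1 * time_integral CARD('n) c 1 t)"
proof -
  have "time_integral CARD('n) c 1 t = set_lebesgue_integral lborel {0<..<t} (\<lambda>\<tau>. exp (c * \<tau>) / sqrt \<tau>)"
    unfolding time_integral_def
    by (intro set_lebesgue_integral_cong) (auto simp: powr_half_sqrt)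
  moreover have "grad_const A 1 = 1 / sqrt pi"
    using det_psd_sqrt_pos[OF A] by (simp add: grad_const_def powr_minus_divide powr_half_sqrt)
  ultimately show ?thesis using v by (simp add: sharp_const_inf_def)
qed

section \<open>The sharp constants\<close>

lemma strip_mono: "t \<le> T \<Longrightarrow> strip t \<subseteq> strip T"
  by (auto simp: strip_def)

lemma set_borel_measurable_strip_mono:
  fixes f :: "(real^'n) \<times> real \<Rightarrow> real"
  assumes "set_borel_measurable lborel (strip T) f" "t \<le> T"
  shows "(\<lambda>z. indicator (strip t) z * f z) \<in> borel_measurable lborel"
proof -
  have "(\<lambda>z. indicator (strip t) z * (indicator (strip T) z *\<^sub>R f z)) \<in> borel_measurable lborel"
    using assms(1) unfolding set_borel_measurable_def by (rule borel_measurable_times[rotated]) measurable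
  moreover have "indicator (strip t) z * (indicator (strip T) z *\<^sub>R f z) = indicator (strip t) z * f z" for z
    using strip_mono[OF assms(2)] by (auto simp: indicator_def)
  ultimately show ?thesis by (simp only:)
qed

lemma in_Lp_restrict:
  fixes f :: "(real^'n) \<times> real \<Rightarrow> real"
  assumes f: "in_Lp p T f" and t: "t \<le> T"
  shows "integrable lborel (\<lambda>z. \<bar>indicator (strip t) z * f z\<bar> powr p)"
    "Lp_norm p t f = (\<integral>z. \<bar>indicator (strip t) z * f z\<bar> powr p \<partial>lborel) powr (1 / p)"
proof -
  have [measurable]: "(\<lambda>z. indicator (strip t) z * f z) \<in> borel_measurable lborel"
    using f t by (intro set_borel_measurable_strip_mono) (auto simp: in_Lp_def)
  have eq: "indicator (strip t) z * ennreal (\<bar>f z\<bar> powr p) = ennreal (\<bar>indicator (strip t) z * f z\<bar> powr p)" for z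
    by (simp add: indicator_def)
  have "(\<integral>\<^sup>+z. indicator (strip t) z * ennreal (\<bar>f z\<bar> powr p) \<partial>lborel)
      \<le> (\<integral>\<^sup>+z. indicator (strip T) z * ennreal (\<bar>f z\<bar> powr p) \<partial>lborel)"
    using strip_mono[OF t] by (intro nn_integral_mono mult_right_mono) (auto simp: indicator_def)
  also have "\<dots> < \<infinity>" using f by (simp add: in_Lp_def)
  finally have fin: "(\<integral>\<^sup>+z. ennreal (\<bar>indicator (strip t) z * f z\<bar> powr p) \<partial>lborel) < \<infinity>" by (simp only: eq)
  then show int: "integrable lborel (\<lambda>z. \<bar>indicator (strip t) z * f z\<bar> powr p)"
    by (intro integrableI_bounded) simp_all
  show "Lp_norm p t f = (\<integral>z. \<bar>indicator (strip t) z * f z\<bar> powr p \<partial>lborel) powr (1 / p)"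
    unfolding Lp_norm_def eq by (subst nn_integral_eq_integral[OF int]) auto
qed

text \<open>\<open>real_of_ereal\<close> sends infinite values to 0, so the essential supremum must
  first be shown to be finite: it is bounded above through the larger strip, and minus infinity is
  excluded by |f z| \<ge> 0.\<close>

lemma AE_le_Linf_norm:
  fixes f :: "(real^'n) \<times> real \<Rightarrow> real"
  assumes f: "in_Linf T f" and t: "t \<le> T"
  shows "AE z in lborel. z \<in> strip t \<longrightarrow> \<bar>f z\<bar> \<le> Linf_norm t f"
proof -
  let ?M = "restrict_space lborel (strip t)" and ?E = "esssup (restrict_space lborel (strip t)) (\<lambda>z. ereal \<bar>f z\<bar>)"
  have "f \<in> borel_measurable ?M"
    using set_borel_measurable_strip_mono[of T f t] f t
    by (subst borel_measurable_restrict_space_iff) (auto simp: in_Linf_def mult.commute)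
  then have m: "(\<lambda>z. ereal \<bar>f z\<bar>) \<in> borel_measurable ?M" by measurable
  obtain B where "AE z in lborel. z \<in> strip T \<longrightarrow> \<bar>f z\<bar> \<le> B" using f by (auto simp: in_Linf_def)
  then have "AE z in ?M. ereal \<bar>f z\<bar> \<le> ereal B"
    using strip_mono[OF t] by (subst AE_restrict_space_iff) (auto elim!: eventually_mono)
  then have "?E \<le> ereal B" using m by (intro esssup_I)
  then have fin: "?E \<noteq> \<infinity>" by auto
  have "AE z in ?M. ereal \<bar>f z\<bar> \<le> ?E" by (rule esssup_AE)
  then have "AE z in lborel. z \<in> strip t \<longrightarrow> ereal \<bar>f z\<bar> \<le> ?E"
    by (subst (asm) AE_restrict_space_iff) auto
  then show ?thesis
  proof eventually_elim
    case (elim z)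
    show ?case
    proof
      assume "z \<in> strip t"
      then have le: "ereal \<bar>f z\<bar> \<le> ?E" using elim by simp
      then show "\<bar>f z\<bar> \<le> Linf_norm t f" using fin unfolding Linf_norm_def by (cases ?E) auto
    qed
  qed
qed

lemma Linf_norm_bounds:
  fixes f :: "(real^'n) \<times> real \<Rightarrow> real"
  assumes [measurable]: "set_borel_measurable lborel (strip T) f" and t: "t \<le> T"
    and B: "\<And>z. z \<in> strip t \<Longrightarrow> \<bar>f z\<bar> \<le> B" "B \<ge> 0"
  shows "Linf_norm t f \<le> B"
proof -
  let ?M = "restrict_space lborel (strip t)" and ?E = "esssup (restrict_space lborel (strip t)) (\<lambda>z. ereal \<bar>f z\<bar>)"
  have "f \<in> borel_measurable ?M"
    using set_borel_measurable_strip_mono[of T f t] assms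
    by (subst borel_measurable_restrict_space_iff) (auto simp: mult.commute)
  then have "(\<lambda>z. ereal \<bar>f z\<bar>) \<in> borel_measurable ?M" by measurable
  then have "?E \<le> ereal B"
    by (rule esssup_I) (rule AE_I2, simp add: space_restrict_space B(1))
  then show ?thesis using B(2) unfolding Linf_norm_def by (cases ?E) auto
qed

text \<open>A negative value would make the almost everywhere bound on |f| fail at every point of
  the strip, which has infinite measure.\<close>

lemma Linf_norm_nonneg:
  fixes f :: "(real^'n) \<times> real \<Rightarrow> real"
  assumes f: "in_Linf T f" and t: "0 < t" "t \<le> T"
  shows "Linf_norm t f \<ge> 0"
proof (rule ccontr)
  assume "\<not> Linf_norm t f \<ge> 0"
  then have neg: "\<not> \<bar>f z\<bar> \<le> Linf_norm t f" for z by linarith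
  have "AE z in lborel. z \<notin> (strip t :: ((real^'n) \<times> real) set)"
    using AE_le_Linf_norm[OF f t(2)] by (simp add: neg)
  then have "emeasure lborel (strip t :: ((real^'n) \<times> real) set) = 0"
    by (subst (asm) AE_iff_measurable[where N="strip t"]) auto
  moreover have "emeasure lborel (strip t :: ((real^'n) \<times> real) set) = \<infinity>"
    using t lborel.emeasure_pair_measure_Times[of "UNIV :: (real^'n) set" lborel "{0<..<t}"]
    by (simp add: strip_def lborel_prod ennreal_top_mult)
  ultimately show False by simp
qed

text \<open>The passage from test functions to the optimal constant: a are derivatives and N norms.
  The norms need only stay below Y. Replacing N by Y requires D \<ge> 0, and a negative D would
  force every a m to vanish, against the positive limit.\<close>

lemma admissible_limit:
  fixes a N :: "nat \<Rightarrow> real"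
  assumes a: "a \<longlonglongrightarrow> X" "X > 0" and le: "\<And>m. \<bar>a m\<bar> \<le> D * N m" and N: "\<And>m. 0 \<le> N m" "\<And>m. N m \<le> Y"
  shows "X \<le> D * Y"
proof -
  have D: "D \<ge> 0"
  proof (rule ccontr)
    assume "\<not> D \<ge> 0"
    then have "D * N m \<le> 0" for m using N(1)[of m] by (simp add: mult_le_0_iff)
    then have "a m = 0" for m using le[of m] by (smt (verit))
    then have "a = (\<lambda>_. 0)" by (rule ext)
    then have "a \<longlonglongrightarrow> 0" by simp
    with a show False using LIMSEQ_unique by fastforce
  qed
  have "a m \<le> D * Y" for m
    using le[of m] mult_left_mono[OF N(2)[of m] D] by linarith
  then show ?thesis by (intro LIMSEQ_le_const2[OF a(1)]) auto
qed

text \<open>The time exponent equals (n + p)/(2(p - 1)), which is below 1 exactly when p > n + 2.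
  The identity (q - 1) p = q turns the bound |P|^(q-1) on the test functions into |P|^q under the
  L^p norm.\<close>

lemma conjugate_exponent:
  fixes n p :: real
  assumes "0 \<le> n" "n + 2 < p"
  shows "p > 1" "p / (p - 1) > 1" "p / (p - 1) < 2" "1 / (p / (p - 1)) + 1 / p = 1"
    "(n * (p / (p - 1) - 1) + p / (p - 1)) / 2 < 1" "(p / (p - 1) - 1) * p = p / (p - 1)"
proof -
  have p2: "p > 2" using assms by linarith
  then show "p > 1" "p / (p - 1) > 1" "p / (p - 1) < 2" "1 / (p / (p - 1)) + 1 / p = 1"
    "(p / (p - 1) - 1) * p = p / (p - 1)"
    by (simp_all add: field_simps)
  have "p / (p - 1) - 1 = 1 / (p - 1)" using p2 by (simp add: field_simps)
  then have "(n * (p / (p - 1) - 1) + p / (p - 1)) / 2 = (n + p) / (2 * (p - 1))"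
    by (simp add: add_divide_distrib diff_divide_distrib right_diff_distrib mult.commute)
  also have "\<dots> < 1" using p2 assms by (simp add: divide_less_eq)
  finally show "(n * (p / (p - 1) - 1) + p / (p - 1)) / 2 < 1" .
qed

lemma inv_sqrt_nonzero:
  assumes A: "symmetric_mat A" "pos_def_mat A"
  shows "norm l = 1 \<Longrightarrow> norm (inv_sqrt A *v l) > 0"
  using inv_sqrt(2)[OF A] unfolding pos_def_mat_def
  by (metis inner_zero_right less_irrefl norm_zero zero_less_norm_iff zero_less_one)

lemma onorm_inv_sqrt_attained:
  fixes A :: "real^'n^'n"
  obtains l where "norm l = 1" "norm (inv_sqrt A *v l) = onorm (\<lambda>v. inv_sqrt A *v v)"
proof -
  let ?R = "\<lambda>v. inv_sqrt A *v v"
  have bl: "bounded_linear ?R" by (rule matrix_vector_mul_bounded_linear)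
  have "compact (sphere (0 :: real^'n) 1)" "sphere (0 :: real^'n) 1 \<noteq> {}" by auto
  then obtain l where l: "l \<in> sphere 0 1" "\<And>y. y \<in> sphere 0 1 \<Longrightarrow> norm (?R y) \<le> norm (?R l)"
    using continuous_attains_sup[of "sphere 0 1" "\<lambda>v. norm (?R v)", OF _ _ continuous_on_norm[OF continuous_on_matrix_vector_mult[OF continuous_on_id]]]
    by blast
  have "onorm ?R \<le> norm (?R l)"
  proof (rule onorm_le)
    fix v :: "real^'n"
    show "norm (?R v) \<le> norm (?R l) * norm v"
    proof (cases "v = 0")
      case False
      then have "norm (?R ((1 / norm v) *\<^sub>R v)) \<le> norm (?R l)" by (intro l(2)) simp
      then show ?thesis using False by (simp add: matrix_vector_mult_scaleR field_simps)
    qed (simp add: matrix_vector_mult_0_right)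
  qed
  moreover have "norm (?R l) \<le> onorm ?R" using onorm[OF bl, of l] l(1) by simp
  ultimately show ?thesis using that l(1) by simp
qed

text \<open>The norm of the gradient is its largest directional derivative, so sharpness in a direction
  maximizing \<open>|A\<^sup>-\<^sup>1\<^sup>/\<^sup>2 l|\<close> gives sharpness for the gradient.\<close>

lemma least_in_gradient:
  fixes A :: "real^'n^'n"
  assumes S: "\<And>u v. 0 \<le> u \<Longrightarrow> u \<le> v \<Longrightarrow> S u \<le> S v" "S 0 \<ge> 0"
    and N: "\<And>f. Q f \<Longrightarrow> 0 \<le> N f"
    and ub: "\<And>l f. norm l = 1 \<Longrightarrow> Q f \<Longrightarrow> \<bar>dir_deriv (heat_solution A b c f) l x t\<bar> \<le> S (norm (inv_sqrt A *v l)) * N f"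
    and lb: "\<And>l D. norm l = 1 \<Longrightarrow> (\<And>f. Q f \<Longrightarrow> \<bar>dir_deriv (heat_solution A b c f) l x t\<bar> \<le> D * N f) \<Longrightarrow> S (norm (inv_sqrt A *v l)) \<le> D"
  shows "least_in {C. \<forall>f. Q f \<longrightarrow> norm (grad_x (heat_solution A b c f) x t) \<le> C * N f} (S (onorm (\<lambda>v. inv_sqrt A *v v)))"
  unfolding least_in_def
proof (intro conjI ballI CollectI allI impI)
  let ?R = "\<lambda>v. inv_sqrt A *v v"
  fix f assume f: "Q f"
  let ?V = "grad_x (heat_solution A b c f) x t"
  have on: "onorm ?R \<ge> 0" by (rule onorm_pos_le[OF matrix_vector_mul_bounded_linear])
  show "norm ?V \<le> S (onorm ?R) * N f"
  proof (cases "?V = 0")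
    case True
    have "0 \<le> S (onorm ?R)" using S(2) S(1)[OF _ on] by force
    then show ?thesis using True N[OF f] by simp
  next
    case False
    \<comment> \<open>This direction depends on f, so the directional bound has to be available for
      every unit vector.\<close>
    define l where "l = (1 / norm ?V) *\<^sub>R ?V"
    have l: "norm l = 1" using False by (simp add: l_def)
    have "norm ?V = ?V \<bullet> l" using False by (simp add: l_def dot_square_norm power2_eq_square)
    also have "\<dots> \<le> S (norm (?R l)) * N f" using ub[OF l f] by (simp add: dir_deriv_def)
    also have "norm (?R l) \<le> onorm ?R" using onorm[OF matrix_vector_mul_bounded_linear, of "inv_sqrt A" l] l by simp
    then have "S (norm (?R l)) * N f \<le> S (onorm ?R) * N f"
      using N[OF f] by (intro mult_right_mono S(1)) auto
    finally show ?thesis .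
  qed
next
  let ?R = "\<lambda>v. inv_sqrt A *v v"
  fix D assume D: "D \<in> {C. \<forall>f. Q f \<longrightarrow> norm (grad_x (heat_solution A b c f) x t) \<le> C * N f}"
  obtain l where l: "norm l = 1" "norm (?R l) = onorm ?R" using onorm_inv_sqrt_attained by blast
  have "S (norm (?R l)) \<le> D"
  proof (rule lb[OF l(1)])
    fix f assume f: "Q f"
    have "\<bar>dir_deriv (heat_solution A b c f) l x t\<bar> \<le> norm (grad_x (heat_solution A b c f) x t)"
      unfolding dir_deriv_def using Cauchy_Schwarz_ineq2[of _ l] l(1) by simp
    also have "\<dots> \<le> D * N f" using D f by simp
    finally show "\<bar>dir_deriv (heat_solution A b c f) l x t\<bar> \<le> D * N f" .
  qed
  then show "S (onorm ?R) \<le> D" by (simp add: l(2))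
qed

section \<open>Upper bounds and sharpness at a fixed point\<close>

context
  fixes A :: "real^'n^'n" and b :: "real^'n" and c :: real and x :: "real^'n" and t T :: real
  assumes A: "symmetric_mat A" "pos_def_mat A" and t: "0 < t" "t < T"
begin

lemma heat_grad_strip_power_integral:
  assumes q: "q > 0" "(real CARD('n) * (q - 1) + q) / 2 < 1"
  shows "integrable lborel (\<lambda>z. \<bar>heat_grad_strip A b c t ((x, t) - z) \<bullet> l\<bar> powr q)"
    "(\<integral>z. \<bar>heat_grad_strip A b c t ((x, t) - z) \<bullet> l\<bar> powr q \<partial>lborel)
     = norm (inv_sqrt A *v l) powr q * (grad_const A q * time_integral CARD('n) c q t)"
proof -
  let ?F = "\<lambda>w. \<bar>heat_grad_strip A b c t w \<bullet> l\<bar> powr q"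
  note nn = nn_integral_heat_grad_strip_powr[OF A q, of b c t l]
  have i: "integrable lborel ?F"
    using nn by (intro integrableI_bounded) simp_all
  from integrable_lborel_reflect[OF this]
  show "integrable lborel (\<lambda>z. \<bar>heat_grad_strip A b c t ((x, t) - z) \<bullet> l\<bar> powr q)" .
  have "time_integral CARD('n) c q t \<ge> 0"
    unfolding time_integral_def set_lebesgue_integral_def by (intro integral_nonneg_AE) auto
  then have "integral\<^sup>L lborel ?F = norm (inv_sqrt A *v l) powr q * (grad_const A q * time_integral CARD('n) c q t)"
    using nn i grad_const_pos[OF A q(1)] by (simp add: nn_integral_eq_integral)
  then show "(\<integral>z. \<bar>heat_grad_strip A b c t ((x, t) - z) \<bullet> l\<bar> powr q \<partial>lborel)
     = norm (inv_sqrt A *v l) powr q * (grad_const A q * time_integral CARD('n) c q t)"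
    by (subst integral_lborel_reflect[of ?F]) simp_all
qed

lemma heat_grad_strip_off: "z \<notin> strip t \<Longrightarrow> heat_grad_strip A b c t ((x, t) - z) = 0"
  by (cases z) (auto simp: heat_grad_strip_def strip_def indicator_def)

lemma dir_deriv_le_Lp:
  assumes p: "real CARD('n) + 2 < p" and f: "in_Lp p T f" "holder_class \<alpha> T f"
  shows "\<bar>dir_deriv (heat_solution A b c f) l x t\<bar> \<le> sharp_const A c p t (norm (inv_sqrt A *v l)) * Lp_norm p t f"
proof -
  define q where "q = p / (p - 1)"
  note pq = conjugate_exponent[OF of_nat_0_le_iff p, folded q_def]
  let ?P = "\<lambda>z. heat_grad_strip A b c t ((x, t) - z) \<bullet> l"
  \<comment> \<open>Measurability and p-integrability of f are known on the strip only; the kernel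
    vanishes off it, so f may be cut off there.\<close>
  let ?f = "\<lambda>z. indicator (strip t) z * f z"
  have "dir_deriv (heat_solution A b c f) l x t = (\<integral>z. ?P z * ?f z \<partial>lborel)"
    unfolding dir_deriv_heat_solution(1)[OF A f(2) t]
    using heat_grad_strip_off by (intro Bochner_Integration.integral_cong) (auto simp: indicator_def)
  moreover have "\<bar>\<integral>z. ?P z * ?f z \<partial>lborel\<bar> \<le> (\<integral>z. \<bar>?P z\<bar> powr q \<partial>lborel) powr (1 / q) * (\<integral>z. \<bar>?f z\<bar> powr p \<partial>lborel) powr (1 / p)"
    using pq t f(1) by (intro Holder_inequality_integral heat_grad_strip_power_integral in_Lp_restrict[of p T] set_borel_measurable_strip_mono[of T])
      (auto simp: in_Lp_def)
  ultimately show ?thesis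
    using pq t heat_grad_strip_power_integral(2)[of q l]
    by (simp add: sharp_const_eq[OF A p _ q_def] in_Lp_restrict(2)[OF f(1)])
qed

lemma dir_deriv_le_Linf:
  assumes f: "in_Linf T f" "holder_class \<alpha> T f"
  shows "\<bar>dir_deriv (heat_solution A b c f) l x t\<bar> \<le> sharp_const_inf c t (norm (inv_sqrt A *v l)) * Linf_norm t f"
proof -
  let ?P = "\<lambda>z. heat_grad_strip A b c t ((x, t) - z) \<bullet> l"
  have P: "integrable lborel (\<lambda>z. \<bar>?P z\<bar>)" "(\<integral>z. \<bar>?P z\<bar> \<partial>lborel) = sharp_const_inf c t (norm (inv_sqrt A *v l))"
    using heat_grad_strip_power_integral[of 1 l] by (simp_all add: sharp_const_inf_eq[OF A])
  note i = dir_deriv_heat_solution(2)[OF A f(2) t, of b c x l]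
  have "\<bar>dir_deriv (heat_solution A b c f) l x t\<bar> \<le> (\<integral>z. \<bar>?P z * f z\<bar> \<partial>lborel)"
    unfolding dir_deriv_heat_solution(1)[OF A f(2) t] by (rule integral_abs_bound)
  also have "\<dots> \<le> (\<integral>z. \<bar>?P z\<bar> * Linf_norm t f \<partial>lborel)"
  proof (rule integral_mono_AE)
    have "AE z in lborel. z \<in> strip t \<longrightarrow> \<bar>f z\<bar> \<le> Linf_norm t f"
      using AE_le_Linf_norm[OF f(1)] t by simp
    then show "AE z in lborel. \<bar>?P z * f z\<bar> \<le> \<bar>?P z\<bar> * Linf_norm t f"
    proof eventually_elim
      case (elim z)
      show ?case
      proof (cases "z \<in> strip t")
        case True
        then show ?thesis using elim by (simp add: abs_mult mult_left_mono)
      qed (simp add: heat_grad_strip_off)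
    qed
  qed (use i P in auto)
  also have "\<dots> = sharp_const_inf c t (norm (inv_sqrt A *v l)) * Linf_norm t f"
    using P by simp
  finally show ?thesis .
qed

lemma extremal_measurable:
  assumes "1 \<le> q" "q < 2"
  shows "extremal A b c l x t q (inverse (real (Suc m))) \<in> borel_measurable borel"
  by (rule borel_measurable_continuous_onI[OF continuous_extremal[OF A assms]]) simp

lemma dir_deriv_extremal_tendsto:
  assumes q: "1 \<le> q" "q < 2" "(real CARD('n) * (q - 1) + q) / 2 < 1"
  shows "(\<lambda>m. dir_deriv (heat_solution A b c (extremal A b c l x t q (inverse (real (Suc m))))) l x t)
    \<longlonglongrightarrow> norm (inv_sqrt A *v l) powr q * (grad_const A q * time_integral CARD('n) c q t)"
proof -
  have "dir_deriv (heat_solution A b c (extremal A b c l x t q (inverse (real (Suc m))))) l x t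
    = (\<integral>z. (heat_grad_strip A b c t ((x, t) - z) \<bullet> l) * extremal A b c l x t q (inverse (real (Suc m))) z \<partial>lborel)" for m
    \<comment> \<open>The formula for the derivative asks for membership in some Hoelder class; the
      exponent 1/2 is an arbitrary choice.\<close>
    using t by (intro dir_deriv_heat_solution(1)[OF A holder_class_extremal[OF A q(1,2), where \<alpha>="1/2"]])
      (auto simp: inverse_le_1_iff)
  then show ?thesis
    using extremal_pairing_tendsto[OF A q(1,2) heat_grad_strip_power_integral(1)] q
    by (simp add: heat_grad_strip_power_integral(2))
qed

lemma heat_grad_power_integral_pos:
  assumes q: "1 \<le> q" "(real CARD('n) * (q - 1) + q) / 2 < 1" and l: "norm l = 1"
  shows "norm (inv_sqrt A *v l) powr q * (grad_const A q * time_integral CARD('n) c q t) > 0"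
  using inv_sqrt_nonzero[OF A l] grad_const_pos[OF A, of q] time_integral_pos[OF t(1), of "CARD('n)" q c] q by simp

text \<open>Let X be the q-th power integral of P. The pairings tend to X while the norms of the
  test functions stay below X^(1/p), so X \<le> D X^(1/p), and dividing leaves X^(1 - 1/p) =
  X^(1/q), the sharp constant.\<close>

lemma sharp_const_le_admissible:
  assumes \<alpha>: "0 < \<alpha>" "\<alpha> < 1" and p: "real CARD('n) + 2 < p" and l: "norm l = 1"
    and D: "\<And>f. in_Lp p T f \<Longrightarrow> holder_class \<alpha> T f \<Longrightarrow> \<bar>dir_deriv (heat_solution A b c f) l x t\<bar> \<le> D * Lp_norm p t f"
  shows "sharp_const A c p t (norm (inv_sqrt A *v l)) \<le> D"
proof -
  define q where "q = p / (p - 1)"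
  note pq = conjugate_exponent[OF of_nat_0_le_iff p, folded q_def]
  have q: "1 \<le> q" "q < 2" "(real CARD('n) * (q - 1) + q) / 2 < 1" using pq by auto
  let ?f = "\<lambda>m. extremal A b c l x t q (inverse (real (Suc m)))"
  let ?P = "\<lambda>z. heat_grad_strip A b c t ((x, t) - z) \<bullet> l"
  define X where "X = norm (inv_sqrt A *v l) powr q * (grad_const A q * time_integral CARD('n) c q t)"
  have X: "X > 0" unfolding X_def by (rule heat_grad_power_integral_pos[OF q(1,3) l])
  have nX: "(\<integral>\<^sup>+z. ennreal (\<bar>?P z\<bar> powr q) \<partial>lborel) = ennreal X"
    using heat_grad_strip_power_integral[of q l] q by (simp add: nn_integral_eq_integral X_def)
  \<comment> \<open>The bound is used twice: with T' = T it puts the functions into the admissible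
    class, with T' = t it controls the norm. After time t they vanish.\<close>
  have le: "(\<integral>\<^sup>+z. indicator (strip T') z * ennreal (\<bar>?f m z\<bar> powr p) \<partial>lborel) \<le> ennreal X" for m T'
    unfolding nX[symmetric]
  proof (rule nn_integral_mono)
    fix z
    show "indicator (strip T') z * ennreal (\<bar>?f m z\<bar> powr p) \<le> ennreal (\<bar>?P z\<bar> powr q)"
    proof (cases "z \<in> strip T' \<and> snd z < t")
      case True
      then have "z \<in> strip t" by (auto simp: strip_def)
      then have "\<bar>?f m z\<bar> \<le> \<bar>?P z\<bar> powr (q - 1)" by (intro abs_extremal_le[OF A q(1,2)]) auto
      then have "\<bar>?f m z\<bar> powr p \<le> (\<bar>?P z\<bar> powr (q - 1)) powr p" using pq by (intro powr_mono2) auto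
      then show ?thesis using True pq(6) by (simp add: powr_powr ennreal_leI)
    next
      case False
      then have "z \<notin> strip T' \<or> ?f m z = 0" by (auto intro!: extremal_eq_0[OF A q(1,2)])
      then show ?thesis by auto
    qed
  qed
  have "in_Lp p T (?f m)" for m
    unfolding in_Lp_def set_borel_measurable_def using le[of T m] extremal_measurable[OF q(1,2), of l m]
    by (auto simp: le_less_trans)
  moreover have "holder_class \<alpha> T (?f m)" for m
    using \<alpha> by (intro holder_class_extremal[OF A q(1,2)]) (auto simp: inverse_le_1_iff)
  ultimately have adm: "\<bar>dir_deriv (heat_solution A b c (?f m)) l x t\<bar> \<le> D * Lp_norm p t (?f m)" for m
    by (rule D)
  have "enn2real (\<integral>\<^sup>+z. indicator (strip t) z * ennreal (\<bar>?f m z\<bar> powr p) \<partial>lborel) \<le> X" for m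
    using enn2real_mono[OF le[of t m]] X by simp
  then have N: "Lp_norm p t (?f m) \<le> X powr (1 / p)" for m
    unfolding Lp_norm_def using pq by (intro powr_mono2) auto
  have "X \<le> D * X powr (1 / p)"
    by (rule admissible_limit[OF dir_deriv_extremal_tendsto[OF q, of l, folded X_def] X adm _ N])
       (simp add: Lp_norm_def)
  then have "X / X powr (1 / p) \<le> D" using X by (simp add: divide_le_eq)
  moreover have "1 / q = 1 - 1 / p" using pq(4) by linarith
  then have "X / X powr (1 / p) = X powr (1 / q)"
    using X powr_diff[of X 1 "1 / p"] by simp
  ultimately show ?thesis by (simp add: sharp_const_eq[OF A p _ q_def] X_def)
qed

text \<open>Here q = 1 and the test functions approximate the sign of P: their norms are at most 1
  and the pairings tend to the L^1 norm of P.\<close>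

lemma sharp_const_inf_le_admissible:
  assumes \<alpha>: "0 < \<alpha>" "\<alpha> < 1" and l: "norm l = 1"
    and D: "\<And>f. in_Linf T f \<Longrightarrow> holder_class \<alpha> T f \<Longrightarrow> \<bar>dir_deriv (heat_solution A b c f) l x t\<bar> \<le> D * Linf_norm t f"
  shows "sharp_const_inf c t (norm (inv_sqrt A *v l)) \<le> D"
proof -
  let ?f = "\<lambda>m. extremal A b c l x t 1 (inverse (real (Suc m)))"
  have le: "\<bar>?f m z\<bar> \<le> 1" if "0 < snd z" for m z
  proof (cases "z \<in> strip t")
    case True
    have "\<bar>?f m z\<bar> \<le> \<bar>heat_grad_strip A b c t ((x, t) - z) \<bullet> l\<bar> powr (1 - 1)"
      using True by (intro abs_extremal_le[OF A]) auto
    also have "\<dots> \<le> 1" by simp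
    finally show ?thesis .
  next
    case False
    then show ?thesis using that extremal_eq_0[OF A, of 1 "inverse (real (Suc m))"] by (cases z) (auto simp: strip_def)
  qed
  have m: "set_borel_measurable lborel (strip T) (?f m)" for m
    unfolding set_borel_measurable_def using extremal_measurable[of 1 l m] by simp
  have Linf: "in_Linf T (?f m)" for m
    unfolding in_Linf_def using m le by (auto intro!: exI[of _ 1] AE_I2 simp: strip_def)
  moreover have "holder_class \<alpha> T (?f m)" for m
    using \<alpha> by (intro holder_class_extremal[OF A]) (auto simp: inverse_le_1_iff)
  ultimately have adm: "\<bar>dir_deriv (heat_solution A b c (?f m)) l x t\<bar> \<le> D * Linf_norm t (?f m)" for m
    by (rule D)
  have "sharp_const_inf c t (norm (inv_sqrt A *v l)) \<le> D * 1"
    unfolding sharp_const_inf_eq[OF A norm_ge_zero]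
  proof (rule admissible_limit[OF dir_deriv_extremal_tendsto heat_grad_power_integral_pos[OF _ _ l] adm])
    show "0 \<le> Linf_norm t (?f m)" for m using Linf_norm_nonneg[OF Linf] t by simp
    show "Linf_norm t (?f m) \<le> 1" for m
      using t le by (intro Linf_norm_bounds[OF m]) (auto simp: strip_def)
  qed auto
  then show ?thesis by simp
qed

end

lemma sharp_const_mono: "u \<le> v \<Longrightarrow> sharp_const A c p t u \<le> sharp_const A c p t v"
  unfolding sharp_const_def Let_def by (intro mult_right_mono divide_right_mono) auto

lemma sharp_const_inf_mono: "u \<le> v \<Longrightarrow> sharp_const_inf c t u \<le> sharp_const_inf c t v"
  unfolding sharp_const_inf_def set_lebesgue_integral_def
  by (intro mult_right_mono divide_right_mono integral_nonneg_AE) (auto simp: indicator_def)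

theorem theorem2:
  fixes A :: "real^'n^'n" and b :: "real^'n" and c \<alpha> T t :: real
    and x l :: "real^'n"
  assumes "symmetric_mat A" and "pos_def_mat A"
    and "0 < \<alpha>" and "\<alpha> < 1"
    and "0 < T" and "0 < t" and "t < T"
    and "norm l = 1"
  shows
   "(\<forall>p::real. real CARD('n) + 2 < p \<longrightarrow>
       least_in {C. \<forall>f. in_Lp p T f \<and> holder_class \<alpha> T f \<longrightarrow>
                  \<bar>dir_deriv (heat_solution A b c f) l x t\<bar> \<le> C * Lp_norm p t f}
               (sharp_const A c p t (norm (inv_sqrt A *v l))) \<and>
       least_in {C. \<forall>f. in_Lp p T f \<and> holder_class \<alpha> T f \<longrightarrow>
                  norm (grad_x (heat_solution A b c f) x t) \<le> C * Lp_norm p t f}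
               (sharp_const A c p t (onorm (\<lambda>v. inv_sqrt A *v v))))
    \<and> least_in {C. \<forall>f. in_Linf T f \<and> holder_class \<alpha> T f \<longrightarrow>
                  \<bar>dir_deriv (heat_solution A b c f) l x t\<bar> \<le> C * Linf_norm t f}
               (sharp_const_inf c t (norm (inv_sqrt A *v l)))
    \<and> least_in {C. \<forall>f. in_Linf T f \<and> holder_class \<alpha> T f \<longrightarrow>
                  norm (grad_x (heat_solution A b c f) x t) \<le> C * Linf_norm t f}
               (sharp_const_inf c t (onorm (\<lambda>v. inv_sqrt A *v v)))
    \<and> (\<forall>f. holder_class \<alpha> T f \<longrightarrow> (\<lambda>y. heat_solution A b c f y t) differentiable (at x))"
proof (intro conjI allI impI)
  note A = assms(1,2) and \<alpha> = assms(3,4) and t = assms(6,7)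
  fix p :: real assume p: "real CARD('n) + 2 < p"
  show "least_in {C. \<forall>f. in_Lp p T f \<and> holder_class \<alpha> T f \<longrightarrow>
                  \<bar>dir_deriv (heat_solution A b c f) l x t\<bar> \<le> C * Lp_norm p t f}
               (sharp_const A c p t (norm (inv_sqrt A *v l)))"
    unfolding least_in_def
    by (intro conjI CollectI ballI sharp_const_le_admissible[OF A t \<alpha> p assms(8)])
       (auto intro: dir_deriv_le_Lp[OF A t p])
  show "least_in {C. \<forall>f. in_Lp p T f \<and> holder_class \<alpha> T f \<longrightarrow>
                  norm (grad_x (heat_solution A b c f) x t) \<le> C * Lp_norm p t f}
               (sharp_const A c p t (onorm (\<lambda>v. inv_sqrt A *v v)))"
  proof (rule least_in_gradient[where S="sharp_const A c p t"])
    show "0 \<le> Lp_norm p t f" for f by (simp add: Lp_norm_def)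
    show "0 \<le> sharp_const A c p t 0" by (simp add: sharp_const_def Let_def)
    show "sharp_const A c p t (norm (inv_sqrt A *v m)) \<le> D" if "norm m = 1"
      "\<And>f. in_Lp p T f \<and> holder_class \<alpha> T f \<Longrightarrow> \<bar>dir_deriv (heat_solution A b c f) m x t\<bar> \<le> D * Lp_norm p t f" for m D
      by (rule sharp_const_le_admissible[OF A t \<alpha> p that(1)]) (use that(2) in blast)
  qed (auto intro: dir_deriv_le_Lp[OF A t p] sharp_const_mono)
next
  note A = assms(1,2) and \<alpha> = assms(3,4) and t = assms(6,7)
  show "least_in {C. \<forall>f. in_Linf T f \<and> holder_class \<alpha> T f \<longrightarrow>
                  \<bar>dir_deriv (heat_solution A b c f) l x t\<bar> \<le> C * Linf_norm t f}
               (sharp_const_inf c t (norm (inv_sqrt A *v l)))"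
    unfolding least_in_def
    by (intro conjI CollectI ballI sharp_const_inf_le_admissible[OF A t \<alpha> assms(8)])
       (auto intro: dir_deriv_le_Linf[OF A t])
  show "least_in {C. \<forall>f. in_Linf T f \<and> holder_class \<alpha> T f \<longrightarrow>
                  norm (grad_x (heat_solution A b c f) x t) \<le> C * Linf_norm t f}
               (sharp_const_inf c t (onorm (\<lambda>v. inv_sqrt A *v v)))"
  proof (rule least_in_gradient[where S="sharp_const_inf c t"])
    show "0 \<le> Linf_norm t f" if "in_Linf T f \<and> holder_class \<alpha> T f" for f
      using Linf_norm_nonneg[of T f t] that t by simp
    show "0 \<le> sharp_const_inf c t 0" by (simp add: sharp_const_inf_def)
    show "sharp_const_inf c t (norm (inv_sqrt A *v m)) \<le> D" if "norm m = 1"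
      "\<And>f. in_Linf T f \<and> holder_class \<alpha> T f \<Longrightarrow> \<bar>dir_deriv (heat_solution A b c f) m x t\<bar> \<le> D * Linf_norm t f" for m D
      by (rule sharp_const_inf_le_admissible[OF A t \<alpha> that(1)]) (use that(2) in blast)
  qed (auto intro: dir_deriv_le_Linf[OF A t] sharp_const_inf_mono)
next
  \<comment> \<open>\<open>grad_x\<close> rests on \<open>frechet_derivative\<close>, a choice
    operator; differentiability certifies that it is the true gradient in the statements
    above.\<close>
  fix f :: "(real^'n) \<times> real \<Rightarrow> real" assume "holder_class \<alpha> T f"
  from heat_solution_gradient(1)[OF assms(1,2) this assms(6,7)]
  show "(\<lambda>y. heat_solution A b c f y t) differentiable (at x)"
    unfolding differentiable_def by blast
qed

end
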